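(* Let $X=\{x_1,\dots,x_n\}$ be a finite connected poset with $|X|>1$, let $K$ be a field, and let $\varphi$ be a Lie automorphism of $I(X,K)$. Then $\varphi$ is a regular Hom-Lie structure on $I(X,K)$ if and only if $\varphi=\xi_\beta\circ\tau_{\theta,\sigma,c}$ for some $\beta\in I(X,K)^*$, some bijection $\theta:\mathcal{B}\to\mathcal{B}$, some map $\sigma:X^2_<\to K^*$ compatible with $\theta$, and some $c=(c_1,\dots,c_n)\in K^n$ with $\sum_{i=1}^n c_i\in K^*$, such that (i) $\theta=\mathrm{id}_{\mathcal{B}}$; (ii) $\sigma(x,y)=1$ for all $x<y$ unless $x\in\mathrm{Min}(X)$ and $y\in\mathrm{Max}(X)$; (iii) $\beta_D=\delta$ and $\beta_J\in Z(J(I(X,K)))$. Moreover, such $\beta$, $\theta$, $\sigma$ and $c$ are unique.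
   Context: $I(X,K)$ is the incidence algebra: the $K$-algebra with basis $\{e_{xy}: x\le y\}$ and product $e_{xy}e_{uv}=e_{xv}$ if $y=u$ and $0$ otherwise; $e_x:=e_{xx}$; $\delta=\sum_{x\in X}e_x$ is the identity; each $f\in I(X,K)$ is written $f=\sum_{x\le y}f(x,y)e_{xy}$; $I(X,K)^*$ is the group of units. $X^2_<=\{(x,y)\in X^2:x<y\}$, $\mathcal{B}=\{e_{xy}:x<y\}$, $J(I(X,K))=\mathrm{Span}_K\mathcal{B}$ is the Jacobson radical, $Z(J(I(X,K)))$ is its center, equal to $\mathrm{Span}_K\{e_{xy}\in\mathcal{B}: x\in\mathrm{Min}(X),\,y\in\mathrm{Max}(X)\}$, where $\mathrm{Min}(X)$, $\mathrm{Max}(X)$ are the sets of minimal and maximal elements of $X$. $D(X,K)=\mathrm{Span}_K\{e_x:x\in X\}$; each $f$ is uniquely $f=f_D+f_J$ with $f_D\in D(X,K)$, $f_J\in J(I(X,K))$. $I(X,K)$ is regarded as a Lie algebra with $[f,g]=fg-gf$; a Lie automorphism is a linear bijection preserving $[\cdot,\cdot]$. $\xi_\beta(f)=\beta f\beta^{-1}$ for $\beta\in I(X,K)^*$. A regular Hom-Lie structure on a Lie algebra $L$ is an automorphism $\varphi$ of the Lie algebra $L$ satisfying $[[a,b],\varphi(c)]+[[b,c],\varphi(a)]+[[c,a],\varphi(b)]=0$ for all $a,b,c\in L$. A bijection $\theta:\mathcal{B}\to\mathcal{B}$ is monotone on maximal chains if for every maximal chain $u_1<\dots<u_m$ in $X$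 there is a maximal chain $v_1<\dots<v_m$ such that either $\theta(e_{u_iu_j})=e_{v_iv_j}$ for all $i<j$, or $\theta(e_{u_iu_j})=e_{v_{m-j+1}v_{m-i+1}}$ for all $i<j$. A map $\sigma:X^2_<\to K^*$ is compatible with $\theta$ if for all $x<y<z$: $\sigma(x,z)=\sigma(x,y)\sigma(y,z)$ if $\theta(e_{xz})=\theta(e_{xy})\theta(e_{yz})$, and $\sigma(x,z)=-\sigma(x,y)\sigma(y,z)$ if $\theta(e_{xz})=\theta(e_{yz})\theta(e_{xy})$. For $\theta$ monotone on maximal chains, $\sigma$ compatible with $\theta$ and $c\in K^n$ with $\sum_i c_i\ne0$, $\tau_{\theta,\sigma,c}$ denotes the Lie automorphism $\tau$ of $I(X,K)$ uniquely determined by: $\tau(D(X,K))\subseteq D(X,K)$, $\tau(e_{xy})=\sigma(x,y)\theta(e_{xy})$ for all $x<y$, and $\tau(e_{x_i})(x_1,x_1)=c_i$ for $i=1,\dots,n$, whenever it exists (the $\theta$ for which it exists are called admissible; $\mathrm{id}_{\mathcal{B}}$ is always admissible). *)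

theory Defs
  imports Complex_Main "HOL-Library.FuncSet"
begin

text \<open>The poset \<open>X\<close> is the type \<open>'a\<close>, of class finite and order; the field \<open>K\<close> is \<open>'k\<close>.\<close>

typedef (overloaded) ('a::order, 'k::zero) incidence =
    "{f :: 'a \<Rightarrow> 'a \<Rightarrow> 'k. \<forall>x y. \<not> x \<le> y \<longrightarrow> f x y = 0}"
  morphisms coef Abs_incidence
  by (rule exI[of _ "\<lambda>_ _. 0"]) simp

setup_lifting type_definition_incidence

lemma incidence_eq_iff: "f = g \<longleftrightarrow> (\<forall>x y. coef f x y = coef g x y)"
  by (simp add: coef_inject[symmetric] fun_eq_iff)

lemma coef_not_le: "\<not> x \<le> y \<Longrightarrow> coef f x y = 0"
  using coef[of f] by simp

instantiation incidence :: ("{finite, order}", field) ring_1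
begin

lift_definition zero_incidence :: "('a, 'b) incidence" is "\<lambda>_ _. 0"
  by simp

lift_definition one_incidence :: "('a, 'b) incidence" is "\<lambda>x y. if x = y then 1 else 0"
  by auto

lift_definition plus_incidence :: "('a, 'b) incidence \<Rightarrow> ('a, 'b) incidence \<Rightarrow> ('a, 'b) incidence"
  is "\<lambda>f g x y. f x y + g x y"
  by simp

lift_definition minus_incidence :: "('a, 'b) incidence \<Rightarrow> ('a, 'b) incidence \<Rightarrow> ('a, 'b) incidence"
  is "\<lambda>f g x y. f x y - g x y"
  by simp

lift_definition uminus_incidence :: "('a, 'b) incidence \<Rightarrow> ('a, 'b) incidence"
  is "\<lambda>f x y. - f x y"
  by simp

text \<open>Summands with \<open>z\<close> outside the interval from \<open>x\<close> to \<open>y\<close> vanish. The lemma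
  \<open>unit_times_unit\<close> below is the multiplication table of the basis.\<close>

lift_definition times_incidence :: "('a, 'b) incidence \<Rightarrow> ('a, 'b) incidence \<Rightarrow> ('a, 'b) incidence"
  is "\<lambda>f g x y. \<Sum>z\<in>UNIV. f x z * g z y"
  by (intro allI impI sum.neutral) (metis mult_not_zero order_trans)

instance
proof
  fix a b c :: "('a, 'b) incidence"
  show "a * b * c = a * (b * c)"
    unfolding incidence_eq_iff times_incidence.rep_eq sum_distrib_left sum_distrib_right mult.assoc
    by (intro allI) (rule sum.swap)
  have "(if x = z then 1 else 0) * coef a z y = (if z = x then coef a x y else 0)"
    "coef a x z * (if z = y then 1 else 0) = (if z = y then coef a x y else 0)" for x y z
    by auto
  then show "1 * a = a" "a * 1 = a"
    by (simp_all add: incidence_eq_iff times_incidence.rep_eq one_incidence.rep_eq)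
  show "(a + b) * c = a * c + b * c" "a * (b + c) = a * b + a * c"
    by (simp_all add: incidence_eq_iff times_incidence.rep_eq plus_incidence.rep_eq
        distrib_left distrib_right sum.distrib)
  show "(0 :: ('a, 'b) incidence) \<noteq> 1"
    by (auto simp: incidence_eq_iff zero_incidence.rep_eq one_incidence.rep_eq)
qed (auto simp: incidence_eq_iff zero_incidence.rep_eq plus_incidence.rep_eq
       minus_incidence.rep_eq uminus_incidence.rep_eq)

end

lift_definition iscale :: "'k \<Rightarrow> ('a::{finite,order}, 'k::field) incidence \<Rightarrow> ('a, 'k) incidence"
  is "\<lambda>a f x y. a * f x y"
  by simp

interpretation incidence: vector_space "iscale :: 'k \<Rightarrow> ('a::{finite,order}, 'k::field) incidence \<Rightarrow> _"
  by unfold_locales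
    (auto simp: incidence_eq_iff iscale.rep_eq plus_incidence.rep_eq algebra_simps)

text \<open>\<open>eunit x y\<close> is $e_{xy}$ when \<open>x \<le> y\<close> (and \<open>0\<close> otherwise).\<close>

lift_definition eunit :: "'a \<Rightarrow> 'a \<Rightarrow> ('a::{finite,order}, 'k::field) incidence"
  is "\<lambda>x y u v. if x \<le> y \<and> u = x \<and> v = y then 1 else 0"
  by auto

lemma unit_times_unit:
  assumes "x \<le> y" "u \<le> v"
  shows "eunit x y * eunit u v = (if y = u then eunit x v else 0)"
proof -
  have "(\<Sum>z\<in>UNIV. coef (eunit x y) a z * coef (eunit u v) z b :: 'b)
      = (if a = x \<and> b = v \<and> y = u then 1 else 0)" for a b
  proof -
    have "coef (eunit x y) a z * coef (eunit u v) z b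
        = (if z = y then if a = x \<and> b = v \<and> y = u then 1 else 0 else (0::'b))" for z
      using assms by (simp add: eunit.rep_eq)
    then show ?thesis by simp
  qed
  moreover have "x \<le> v" if "y = u"
    using assms that by (metis order_trans)
  ultimately show ?thesis
    by (simp add: incidence_eq_iff times_incidence.rep_eq eunit.rep_eq zero_incidence.rep_eq)
qed

lemma unit_decomp: "f = (\<Sum>x\<in>UNIV. \<Sum>y\<in>UNIV. iscale (coef f x y) (eunit x y))"
proof -
  have *: "coef (sum h A) u v = (\<Sum>x\<in>A. coef (h x) u v)"
    for h :: "'a \<Rightarrow> ('a, 'b) incidence" and A u v
    by (induction A rule: infinite_finite_induct)
      (auto simp: zero_incidence.rep_eq plus_incidence.rep_eq)
  have **: "coef f x y * (if x \<le> y \<and> u = x \<and> v = y then 1 else 0)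
      = (if y = v then if x = u then coef f u v else 0 else 0)" for x y u v
    by (auto simp: coef_not_le)
  show ?thesis
    unfolding incidence_eq_iff by (simp add: * ** iscale.rep_eq eunit.rep_eq)
qed

definition diag_sub :: "('a::{finite,order}, 'k::field) incidence set" where
  "diag_sub = incidence.span (range (\<lambda>x. eunit x x))"

definition strict_basis :: "('a::{finite,order}, 'k::field) incidence set" where
  "strict_basis = {eunit x y | x y. x < y}"

definition jac :: "('a::{finite,order}, 'k::field) incidence set" where
  "jac = incidence.span strict_basis"

definition center_jac :: "('a::{finite,order}, 'k::field) incidence set" where
  "center_jac = {z \<in> jac. \<forall>f\<in>jac. z * f = f * z}"

definition diag_part :: "('a::{finite,order}, 'k::field) incidence \<Rightarrow> ('a, 'k) incidence" where
  "diag_part f = (\<Sum>x\<in>UNIV. iscale (coef f x x) (eunit x x))"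

definition jac_part :: "('a::{finite,order}, 'k::field) incidence \<Rightarrow> ('a, 'k) incidence" where
  "jac_part f = f - diag_part f"

lemma diag_subD: "f \<in> diag_sub \<Longrightarrow> x \<noteq> y \<Longrightarrow> coef f x y = 0"
  unfolding diag_sub_def
  by (induction rule: incidence.span_induct_alt)
    (auto simp: zero_incidence.rep_eq plus_incidence.rep_eq iscale.rep_eq eunit.rep_eq split: if_splits)

lemma jacD: "f \<in> jac \<Longrightarrow> coef f x x = 0"
  unfolding jac_def
  by (induction rule: incidence.span_induct_alt)
    (auto simp: zero_incidence.rep_eq plus_incidence.rep_eq iscale.rep_eq eunit.rep_eq strict_basis_def
      split: if_splits)

lemma diag_part_in: "diag_part f \<in> diag_sub"
  unfolding diag_part_def diag_sub_def
  by (intro incidence.span_sum incidence.span_scale incidence.span_base) auto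

lemma jac_part_in: "jac_part f \<in> jac"
proof -
  have "(\<Sum>y\<in>UNIV. iscale (coef f x y) (eunit x y))
      = iscale (coef f x x) (eunit x x) + (\<Sum>y\<in>UNIV - {x}. iscale (coef f x y) (eunit x y))" for x
    by (simp add: sum.remove)
  then have "f = diag_part f + (\<Sum>x\<in>UNIV. \<Sum>y\<in>UNIV - {x}. iscale (coef f x y) (eunit x y))"
    by (subst unit_decomp[of f]) (simp add: diag_part_def sum.distrib)
  then have eq: "jac_part f = (\<Sum>x\<in>UNIV. \<Sum>y\<in>UNIV - {x}. iscale (coef f x y) (eunit x y))"
    unfolding jac_part_def by (simp add: algebra_simps)
  have "iscale (coef f x y) (eunit x y) \<in> jac" if "y \<noteq> x" for x y
  proof (cases "x < y")
    case True
    then show ?thesis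
      unfolding jac_def strict_basis_def by (intro incidence.span_scale incidence.span_base) auto
  next
    case False
    with that have "coef f x y = 0" by (auto intro: coef_not_le)
    then show ?thesis by (simp add: jac_def incidence.span_zero)
  qed
  then show ?thesis
    unfolding eq by (auto simp: jac_def intro!: incidence.span_sum)
qed

lemma diag_jac_unique:
  assumes "d \<in> diag_sub" "j \<in> jac" "f = d + j"
  shows "d = diag_part f" "j = jac_part f"
proof -
  have dj: "d - diag_part f = jac_part f - j"
    using assms(3) by (simp add: jac_part_def algebra_simps)
  have "d - diag_part f \<in> diag_sub"
    using assms(1) diag_part_in unfolding diag_sub_def by (rule incidence.span_diff)
  moreover have "d - diag_part f \<in> jac"
    unfolding dj using jac_part_in assms(2) unfolding jac_def by (rule incidence.span_diff)
  ultimately have "d - diag_part f = 0"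
    by (metis diag_subD incidence_eq_iff jacD zero_incidence.rep_eq)
  with dj show "d = diag_part f" "j = jac_part f" by auto
qed

definition is_inverse :: "'r::ring_1 \<Rightarrow> 'r \<Rightarrow> bool" where
  "is_inverse b b' \<longleftrightarrow> b * b' = 1 \<and> b' * b = 1"

definition unit_group :: "'r::ring_1 set" where
  "unit_group = {b. \<exists>b'. is_inverse b b'}"

definition conj_by :: "'r::ring_1 \<Rightarrow> 'r \<Rightarrow> 'r" where
  "conj_by b f = b * f * (THE b'. is_inverse b b')"

definition lie_bracket :: "'r::ring_1 \<Rightarrow> 'r \<Rightarrow> 'r" where
  "lie_bracket f g = f * g - g * f"

definition lie_automorphism ::
    "(('a::{finite,order}, 'k::field) incidence \<Rightarrow> ('a, 'k) incidence) \<Rightarrow> bool" where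
  "lie_automorphism \<phi> \<longleftrightarrow> Vector_Spaces.linear iscale iscale \<phi> \<and> bij \<phi> \<and>
     (\<forall>f g. \<phi> (lie_bracket f g) = lie_bracket (\<phi> f) (\<phi> g))"

definition regular_hom_lie ::
    "(('a::{finite,order}, 'k::field) incidence \<Rightarrow> ('a, 'k) incidence) \<Rightarrow> bool" where
  "regular_hom_lie \<phi> \<longleftrightarrow> lie_automorphism \<phi> \<and>
     (\<forall>a b c. lie_bracket (lie_bracket a b) (\<phi> c) + lie_bracket (lie_bracket b c) (\<phi> a)
        + lie_bracket (lie_bracket c a) (\<phi> b) = 0)"

definition connected_poset :: "'a::order set \<Rightarrow> bool" where
  "connected_poset A \<longleftrightarrow>
     (\<forall>x\<in>A. \<forall>y\<in>A. (\<lambda>u v. u \<in> A \<and> v \<in> A \<and> (u \<le> v \<or> v \<le> u))\<^sup>*\<^sup>* x y)"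

definition min_elements :: "'a::order set" where
  "min_elements = {x. \<forall>y. \<not> y < x}"

definition max_elements :: "'a::order set" where
  "max_elements = {x. \<forall>y. \<not> x < y}"

definition strict_pairs :: "('a::order \<times> 'a) set" where
  "strict_pairs = {(x, y). x < y}"

definition maximal_chain_list :: "'a::order list \<Rightarrow> bool" where
  "maximal_chain_list us \<longleftrightarrow> sorted_wrt (<) us \<and> pred_on.maxchain UNIV (<) (set us)"

text \<open>Lists are indexed from \<open>0\<close>, so the reversed index of \<open>i\<close> is \<open>m - 1 - i\<close>.\<close>

definition monotone_on_max_chains ::
    "(('a::{finite,order}, 'k::field) incidence \<Rightarrow> ('a, 'k) incidence) \<Rightarrow> bool" where
  "monotone_on_max_chains \<theta> \<longleftrightarrow>
     (\<forall>us. maximal_chain_list us \<longrightarrow>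
       (\<exists>vs. maximal_chain_list vs \<and> length vs = length us \<and>
         ((\<forall>i j. i < j \<and> j < length us \<longrightarrow>
             \<theta> (eunit (us ! i) (us ! j)) = eunit (vs ! i) (vs ! j)) \<or>
          (\<forall>i j. i < j \<and> j < length us \<longrightarrow>
             \<theta> (eunit (us ! i) (us ! j)) =
               eunit (vs ! (length us - 1 - j)) (vs ! (length us - 1 - i))))))"

definition compatible_with ::
    "(('a::{finite,order}, 'k::field) incidence \<Rightarrow> ('a, 'k) incidence) \<Rightarrow> ('a \<times> 'a \<Rightarrow> 'k) \<Rightarrow> bool" where
  "compatible_with \<theta> \<sigma> \<longleftrightarrow>
     (\<forall>x y z. x < y \<and> y < z \<longrightarrow>
       (\<theta> (eunit x z) = \<theta> (eunit x y) * \<theta> (eunit y z) \<longrightarrow> \<sigma> (x, z) = \<sigma> (x, y) * \<sigma> (y, z)) \<and>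
       (\<theta> (eunit x z) = \<theta> (eunit y z) * \<theta> (eunit x y) \<longrightarrow> \<sigma> (x, z) = - (\<sigma> (x, y) * \<sigma> (y, z))))"

text \<open>The list \<open>xs\<close> is the enumeration $x_1, \dots, x_n$ of the poset, and \<open>cs\<close> is the vector
  $(c_1, \dots, c_n)$.\<close>

definition is_tau ::
    "'a::{finite,order} list \<Rightarrow> (('a, 'k::field) incidence \<Rightarrow> ('a, 'k) incidence) \<Rightarrow> ('a \<times> 'a \<Rightarrow> 'k)
      \<Rightarrow> 'k list \<Rightarrow> (('a, 'k) incidence \<Rightarrow> ('a, 'k) incidence) \<Rightarrow> bool" where
  "is_tau xs \<theta> \<sigma> cs \<tau> \<longleftrightarrow> lie_automorphism \<tau> \<and> \<tau> ` diag_sub \<subseteq> diag_sub \<and>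
     (\<forall>x y. x < y \<longrightarrow> \<tau> (eunit x y) = iscale (\<sigma> (x, y)) (\<theta> (eunit x y))) \<and>
     (\<forall>i < length xs. coef (\<tau> (eunit (xs ! i) (xs ! i))) (xs ! 0) (xs ! 0) = cs ! i)"

definition tau_exists ::
    "'a::{finite,order} list \<Rightarrow> (('a, 'k::field) incidence \<Rightarrow> ('a, 'k) incidence) \<Rightarrow> ('a \<times> 'a \<Rightarrow> 'k)
      \<Rightarrow> 'k list \<Rightarrow> bool" where
  "tau_exists xs \<theta> \<sigma> cs \<longleftrightarrow> (\<exists>\<tau>. is_tau xs \<theta> \<sigma> cs \<tau>)"

text \<open>Meaningful only under \<open>tau_exists\<close>; uniqueness is \<open>is_tau_unique\<close>.\<close>

definition tau ::
    "'a::{finite,order} list \<Rightarrow> (('a, 'k::field) incidence \<Rightarrow> ('a, 'k) incidence) \<Rightarrow> ('a \<times> 'a \<Rightarrow> 'k)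
      \<Rightarrow> 'k list \<Rightarrow> ('a, 'k) incidence \<Rightarrow> ('a, 'k) incidence" where
  "tau xs \<theta> \<sigma> cs = (THE \<tau>. is_tau xs \<theta> \<sigma> cs \<tau>)"

lemma lie_bracket_diag_unit:
  assumes d: "d \<in> diag_sub" and uv: "u < v"
  shows "coef (lie_bracket d (eunit u v)) u v = coef d u u - coef d v v"
proof -
  have "coef d u z * (if z = u then 1 else 0) = (if z = u then coef d u u else 0)"
    "(if z = v then 1 else 0) * coef d z v = (if z = v then coef d v v else 0)" for z
    by auto
  then show ?thesis
    using uv by (simp add: lie_bracket_def minus_incidence.rep_eq times_incidence.rep_eq eunit.rep_eq
        less_imp_le)
qed

lemma is_tau_unique:
  fixes \<theta> :: "('a::{finite,order}, 'k::field) incidence \<Rightarrow> ('a, 'k) incidence"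
  assumes xs: "set xs = UNIV" and conn: "connected_poset (UNIV :: 'a set)"
    and \<theta>: "bij_betw \<theta> strict_basis strict_basis"
    and \<sigma>: "\<And>x y. x < y \<Longrightarrow> \<sigma> (x, y) \<noteq> 0"
    and \<tau>: "is_tau xs \<theta> \<sigma> cs \<tau>" and \<tau>': "is_tau xs \<theta> \<sigma> cs \<tau>'"
  shows "\<tau> = \<tau>'"
proof -
  have lin: "Vector_Spaces.linear iscale iscale \<tau>" "Vector_Spaces.linear iscale iscale \<tau>'"
    using \<tau> \<tau>' by (auto simp: is_tau_def lie_automorphism_def)
  interpret t: Vector_Spaces.linear iscale iscale \<tau> by (fact lin)
  interpret t': Vector_Spaces.linear iscale iscale \<tau>' by (fact lin)
  have lt: "\<tau> (eunit a b) = \<tau>' (eunit a b)" if "a < b" for a b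
    using \<tau> \<tau>' that by (simp add: is_tau_def)
  have diag: "\<tau> (eunit x x) = \<tau>' (eunit x x)" for x
  proof -
    define d where "d = \<tau> (eunit x x) - \<tau>' (eunit x x)"
    have "eunit x x \<in> diag_sub" unfolding diag_sub_def by (intro incidence.span_base) auto
    then have "\<tau> (eunit x x) \<in> diag_sub" "\<tau>' (eunit x x) \<in> diag_sub"
      using \<tau> \<tau>' by (auto simp: is_tau_def)
    then have d: "d \<in> diag_sub"
      unfolding d_def diag_sub_def by (rule incidence.span_diff)
    have step: "coef d u u = coef d v v" if uv: "u < v" for u v
    proof -
      have "eunit u v \<in> \<theta> ` strict_basis"
        using \<theta> uv by (auto simp: bij_betw_def strict_basis_def)
      then obtain a b where ab: "a < b" "\<theta> (eunit a b) = eunit u v"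
        by (auto simp: strict_basis_def)
      have img: "\<tau> (eunit a b) = iscale (\<sigma> (a, b)) (eunit u v)"
          "\<tau>' (eunit a b) = iscale (\<sigma> (a, b)) (eunit u v)"
        using \<tau> \<tau>' ab by (auto simp: is_tau_def)
      have "lie_bracket (eunit x x) (eunit a b) \<in> {0, eunit a b, - eunit a b :: ('a, 'k) incidence}"
        using ab(1) by (auto simp: lie_bracket_def unit_times_unit less_imp_le)
      then have "\<tau> (lie_bracket (eunit x x) (eunit a b)) = \<tau>' (lie_bracket (eunit x x) (eunit a b))"
        using lt[OF ab(1)] by (auto simp: t.neg t'.neg t.zero t'.zero)
      then have "lie_bracket (\<tau> (eunit x x)) (\<tau> (eunit a b)) = lie_bracket (\<tau>' (eunit x x)) (\<tau>' (eunit a b))"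
        using \<tau> \<tau>' by (simp add: is_tau_def lie_automorphism_def)
      then have "lie_bracket d (iscale (\<sigma> (a, b)) (eunit u v)) = 0"
        unfolding img by (simp add: d_def lie_bracket_def algebra_simps)
      moreover have "lie_bracket d (iscale (\<sigma> (a, b)) (eunit u v))
          = iscale (\<sigma> (a, b)) (lie_bracket d (eunit u v))"
        by (simp add: incidence_eq_iff lie_bracket_def minus_incidence.rep_eq times_incidence.rep_eq
            iscale.rep_eq sum_distrib_left algebra_simps)
      ultimately have "lie_bracket d (eunit u v) = 0"
        using \<sigma>[OF ab(1)] by simp
      then show ?thesis
        using lie_bracket_diag_unit[OF d uv] by (simp add: zero_incidence.rep_eq)
    qed
    have const: "coef d u u = coef d v v" for u v
    proof -
      have "(\<lambda>u v. u \<in> (UNIV::'a set) \<and> v \<in> (UNIV::'a set) \<and> (u \<le> v \<or> v \<le> u))\<^sup>*\<^sup>* u v"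
        using conn by (auto simp: connected_poset_def)
      then show ?thesis
        by induction (use step in \<open>auto simp: order.order_iff_strict\<close>)
    qed
    obtain i where i: "i < length xs" "xs ! i = x"
      using xs by (metis UNIV_I in_set_conv_nth)
    have "coef d (xs ! 0) (xs ! 0) = 0"
      using \<tau> \<tau>' i by (auto simp: is_tau_def d_def minus_incidence.rep_eq)
    then have "d = 0"
      unfolding incidence_eq_iff by (metis const d diag_subD zero_incidence.rep_eq)
    then show ?thesis by (simp add: d_def)
  qed
  have "\<tau> (eunit x y) = \<tau>' (eunit x y)" for x y
  proof (cases "x \<le> y")
    case True
    then show ?thesis using lt diag by (auto simp: order.order_iff_strict)
  next
    case False
    then have "eunit x y = (0 :: ('a, 'k) incidence)"
      by (simp add: incidence_eq_iff eunit.rep_eq zero_incidence.rep_eq)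
    then show ?thesis by (simp add: t.zero t'.zero)
  qed
  then have "\<tau> f = \<tau>' f" for f
    by (subst (1 2) unit_decomp[of f]) (simp add: t.sum t'.sum t.scale t'.scale)
  then show ?thesis by auto
qed

end

theory Submission
  imports Defs
begin

text \<open>
  Evaluating the Hom-Jacobi identity on triples of basis elements that contain an idempotent \<open>e\<^sub>x\<close>
  yields commutation relations between the \<open>e\<^sub>u\<^sub>v\<close> and the images \<open>\<phi> e\<^sub>x\<close>, \<open>\<phi> e\<^sub>p\<^sub>q\<close>. Comparing the
  weights of \<open>e\<^sub>u\<^sub>v\<close> under all \<open>ad e\<^sub>x\<close> with those of \<open>\<phi> e\<^sub>u\<^sub>v\<close> under all \<open>ad (\<phi> e\<^sub>x)\<close> forces
  \<open>\<phi> e\<^sub>u\<^sub>v\<close> to be a multiple of \<open>e\<^sub>u\<^sub>v\<close> and \<open>\<phi> e\<^sub>x\<close> to be diagonal up to a bracket with a central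
  element of the radical; no classification of Lie automorphisms is needed. Conversely, a normal
  form satisfies \<open>[J, \<phi> f - f] = 0\<close> for all \<open>f\<close>; since \<open>[a, b]\<close> lies in the radical \<open>J\<close>, the
  Hom-Jacobi identity reduces to the Jacobi identity.
\<close>

section \<open>Coefficients\<close>

lemmas coef_simps = zero_incidence.rep_eq one_incidence.rep_eq plus_incidence.rep_eq
  minus_incidence.rep_eq uminus_incidence.rep_eq iscale.rep_eq eunit.rep_eq

lemma incidence_eqI: "(\<And>x y. x \<le> y \<Longrightarrow> coef f x y = coef g x y) \<Longrightarrow> f = g"
  unfolding incidence_eq_iff by (metis coef_not_le)

lemma coef_eqD: "f = g \<Longrightarrow> coef f x y = coef g x y"
  by simp

lemma unit_nonzero:
  assumes "u \<le> v"
  shows "eunit u v \<noteq> (0 :: ('a::{finite,order}, 'k::field) incidence)"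
proof
  assume "eunit u v = (0 :: ('a, 'k) incidence)"
  from coef_eqD[OF this, of u v] show False
    using assms by (simp add: coef_simps)
qed

lemma coef_sum: "coef (sum h A) x y = (\<Sum>i\<in>A. coef (h i) x y)"
  by (induction A rule: infinite_finite_induct) (auto simp: coef_simps)

lemma sum_UNIV_single:
  fixes h :: "'a::finite \<Rightarrow> 'b::comm_monoid_add"
  assumes "\<And>z. z \<noteq> x \<Longrightarrow> h z = 0"
  shows "(\<Sum>z\<in>UNIV. h z) = h x"
  using assms by (subst sum.remove[of _ x]) auto

lemma coef_times_unit:
  "u \<le> v \<Longrightarrow> coef (f * eunit u v) x y = (if y = v then coef f x u else 0)"
proof -
  assume "u \<le> v"
  then have "coef f x z * coef (eunit u v) z y = (if z = u then if y = v then coef f x u else 0 else 0)" for z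
    by (simp add: eunit.rep_eq)
  then show ?thesis
    by (simp add: times_incidence.rep_eq)
qed

lemma coef_unit_times:
  "u \<le> v \<Longrightarrow> coef (eunit u v * f) x y = (if x = u then coef f v y else 0)"
proof -
  assume "u \<le> v"
  then have "coef (eunit u v) x z * coef f z y = (if z = v then if x = u then coef f v y else 0 else 0)" for z
    by (simp add: eunit.rep_eq)
  then show ?thesis
    by (simp add: times_incidence.rep_eq)
qed

lemma coef_times_diag: "coef (f * g) x x = coef f x x * coef g x x"
proof -
  have "coef f x z * coef g z x = 0" if "z \<noteq> x" for z
    using that by (metis antisym coef_not_le mult_zero_left mult_zero_right)
  then show ?thesis
    unfolding times_incidence.rep_eq by (rule sum_UNIV_single)
qed

lemma diag_sub_iff: "f \<in> diag_sub \<longleftrightarrow> (\<forall>x y. x \<noteq> y \<longrightarrow> coef f x y = 0)"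
proof
  assume *: "\<forall>x y. x \<noteq> y \<longrightarrow> coef f x y = 0"
  have "coef (diag_part f) x y = coef f x y" for x y
  proof -
    have "coef (iscale (coef f z z) (eunit z z)) x y = (if z = x then coef f x y else 0)" for z
      using * by (auto simp: coef_simps)
    then show ?thesis
      by (simp add: diag_part_def coef_sum)
  qed
  then have "f = diag_part f"
    by (simp add: incidence_eq_iff)
  then show "f \<in> diag_sub"
    by (metis diag_part_in)
qed (simp add: diag_subD)

lemma jac_iff: "f \<in> jac \<longleftrightarrow> (\<forall>x. coef f x x = 0)"
proof
  assume "\<forall>x. coef f x x = 0"
  then have "jac_part f = f"
    by (simp add: jac_part_def diag_part_def)
  then show "f \<in> jac"
    by (metis jac_part_in)
qed (simp add: jacD)

lemma unit_in_jac: "u < v \<Longrightarrow> eunit u v \<in> jac"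
  by (auto simp: jac_iff coef_simps)

lemma unit_in_strict_basis: "u < v \<Longrightarrow> eunit u v \<in> strict_basis"
  by (auto simp: strict_basis_def)

lemma one_in_diag_sub: "1 \<in> diag_sub"
  by (simp add: diag_sub_iff coef_simps)

lemma coef_diag_times: "d \<in> diag_sub \<Longrightarrow> coef (d * f) x y = coef d x x * coef f x y"
proof -
  assume "d \<in> diag_sub"
  then show ?thesis
    unfolding times_incidence.rep_eq by (intro sum_UNIV_single) (auto simp: diag_sub_iff)
qed

lemma coef_times_diag_sub: "d \<in> diag_sub \<Longrightarrow> coef (f * d) x y = coef f x y * coef d y y"
proof -
  assume "d \<in> diag_sub"
  then show ?thesis
    unfolding times_incidence.rep_eq by (intro sum_UNIV_single) (auto simp: diag_sub_iff)
qed

text \<open>Descent on the size of the interval: a nonzero coefficient at a proper subinterval of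
  \<open>{p..q}\<close> replaces \<open>p\<close>, \<open>q\<close> by a strictly smaller interval,
  and intervals are finite.\<close>

lemma minimal_support_exists:
  fixes g :: "('a::{finite,order}, 'k::zero) incidence"
  assumes "coef g p q \<noteq> 0"
  shows "\<exists>a b. p \<le> a \<and> b \<le> q \<and> coef g a b \<noteq> 0 \<and>
    (\<forall>c d. a \<le> c \<longrightarrow> c \<le> d \<longrightarrow> d \<le> b \<longrightarrow> coef g c d \<noteq> 0 \<longrightarrow> c = a \<and> d = b)"
  using assms
proof (induction "card {p..q}" arbitrary: p q rule: less_induct)
  case less
  have "p \<le> q" using less.prems coef_not_le by blast
  show ?case
  proof (cases "\<forall>c d. p \<le> c \<longrightarrow> c \<le> d \<longrightarrow> d \<le> q \<longrightarrow> coef g c d \<noteq> 0 \<longrightarrow> c = p \<and> d = q")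
    case True
    then show ?thesis using less.prems by (intro exI[of _ p] exI[of _ q]) simp
  next
    case False
    then obtain c d where cd: "p \<le> c" "c \<le> d" "d \<le> q" "coef g c d \<noteq> 0" "c \<noteq> p \<or> d \<noteq> q"
      by blast
    then have "{c..d} \<subset> {p..q}"
      using \<open>p \<le> q\<close> by (auto simp: psubset_eq atLeastatMost_subset_iff Icc_eq_Icc)
    then have "card {c..d} < card {p..q}" by (intro psubset_card_mono) auto
    from less.hyps[OF this cd(4)] show ?thesis
      using cd by (meson order_trans)
  qed
qed

text \<open>Reduces a condition that is linear in \<open>f\<close> to the basis elements.\<close>

lemma incidence_subspace_induct:
  assumes "incidence.subspace S" "\<And>x y. x \<le> y \<Longrightarrow> eunit x y \<in> S"
  shows "f \<in> S"
proof -
  have "iscale (coef f x y) (eunit x y) \<in> S" for x y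
    using assms by (cases "x \<le> y")
      (auto simp: coef_not_le incidence.subspace_scale incidence.subspace_0)
  then show ?thesis
    by (subst unit_decomp[of f]) (intro incidence.subspace_sum assms(1))
qed

section \<open>Brackets\<close>

lemma lie_bracket_bilinear [simp]:
  "lie_bracket (f + g) h = lie_bracket f h + lie_bracket g h"
  "lie_bracket h (f + g) = lie_bracket h f + lie_bracket h g"
  "lie_bracket (- f) h = - lie_bracket f h"
  "lie_bracket h (- f) = - lie_bracket h f"
  "lie_bracket (f - g) h = lie_bracket f h - lie_bracket g h"
  "lie_bracket h (f - g) = lie_bracket h f - lie_bracket h g"
  "lie_bracket 0 h = 0"
  "lie_bracket h 0 = 0"
  by (simp_all add: lie_bracket_def algebra_simps)

lemma times_iscale [simp]: "f * iscale a g = iscale a (f * g)" "iscale a f * g = iscale a (f * g)"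
  by (simp_all add: incidence_eq_iff times_incidence.rep_eq coef_simps sum_distrib_left algebra_simps)

lemma lie_bracket_iscale [simp]:
  "lie_bracket f (iscale a g) = iscale a (lie_bracket f g)"
  "lie_bracket (iscale a f) g = iscale a (lie_bracket f g)"
  by (simp_all add: lie_bracket_def incidence.scale_right_diff_distrib)

lemma lie_bracket_skew: "lie_bracket f g = - lie_bracket g f"
  by (simp add: lie_bracket_def)

lemma lie_bracket_zero_iff: "lie_bracket f g = 0 \<longleftrightarrow> f * g = g * f"
  by (simp add: lie_bracket_def)

lemma coef_lie_bracket_unit:
  "u \<le> v \<Longrightarrow> coef (lie_bracket f (eunit u v)) x y =
     (if y = v then coef f x u else 0) - (if x = u then coef f v y else 0)"
  by (simp add: lie_bracket_def coef_simps coef_times_unit coef_unit_times)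

lemma coef_unit_lie_bracket:
  "u \<le> v \<Longrightarrow> coef (lie_bracket (eunit u v) f) x y =
     (if x = u then coef f v y else 0) - (if y = v then coef f x u else 0)"
  by (simp add: lie_bracket_def coef_simps coef_times_unit coef_unit_times)

lemma coef_lie_bracket_diag: "coef (lie_bracket f g) x x = 0"
  by (simp add: lie_bracket_def coef_simps coef_times_diag)

lemma lie_bracket_in_jac: "lie_bracket f g \<in> jac"
  by (simp add: jac_iff coef_lie_bracket_diag)

section \<open>Weights of the basis elements under brackets with idempotents\<close>

definition weight :: "'a \<Rightarrow> 'a \<Rightarrow> 'a \<Rightarrow> 'k::field" where
  "weight x u v = (if x = u then 1 else if x = v then - 1 else 0)"

lemma weight_simps:
  fixes u v :: "'a::order"
  shows
  "weight u u v = 1"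
  "u < v \<Longrightarrow> weight v u v = - 1"
  "x \<noteq> u \<Longrightarrow> x \<noteq> v \<Longrightarrow> weight x u v = 0"
  by (auto simp: weight_def)

lemma bracket_idem_unit: "u < v \<Longrightarrow> lie_bracket (eunit x x) (eunit u v) = iscale (weight x u v) (eunit u v)"
  by (auto simp: lie_bracket_def unit_times_unit less_imp_le weight_def)

lemma bracket_unit_idem: "u < v \<Longrightarrow> lie_bracket (eunit u v) (eunit x x) = - iscale (weight x u v) (eunit u v)"
  by (subst lie_bracket_skew) (simp add: bracket_idem_unit)

lemma bracket_idem_idem: "lie_bracket (eunit x x) (eunit y y) = 0"
  by (auto simp: lie_bracket_def unit_times_unit)

lemma bracket_unit_unit: "u < v \<Longrightarrow> v < w \<Longrightarrow> lie_bracket (eunit u v) (eunit v w) = eunit u w"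
  by (auto simp: lie_bracket_def unit_times_unit less_imp_le)

lemma bracket_unit_unit_zero:
  "u < v \<Longrightarrow> p < q \<Longrightarrow> v \<noteq> p \<Longrightarrow> q \<noteq> u \<Longrightarrow> lie_bracket (eunit u v) (eunit p q) = 0"
  by (auto simp: lie_bracket_def unit_times_unit less_imp_le)

section \<open>The center of the radical\<close>

text \<open>Bracketing with \<open>e_vu\<close> for \<open>v < u\<close> moves the coefficient of
  \<open>z\<close> at \<open>(u, w)\<close> to \<open>(v, w)\<close>, so commuting with the radical
  rules out any \<open>v\<close> below \<open>u\<close>; dually there is nothing above
  \<open>w\<close>. Conversely such a \<open>z\<close> annihilates the radical on both
  sides.\<close>

lemma center_jac_iff:
  "z \<in> center_jac \<longleftrightarrow> (\<forall>u w. coef z u w \<noteq> 0 \<longrightarrow> u < w \<and> u \<in> min_elements \<and> w \<in> max_elements)"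
    (is "_ \<longleftrightarrow> ?R")
proof
  assume z: "z \<in> center_jac"
  then have comm: "lie_bracket (eunit u v) z = 0" if "u < v" for u v
    using that by (simp add: center_jac_def unit_in_jac lie_bracket_zero_iff)
  show ?R
  proof (intro allI impI)
    fix u w assume nz: "coef z u w \<noteq> 0"
    have "u \<le> w" using nz coef_not_le by blast
    moreover have "u \<noteq> w"
      using z nz by (auto simp: center_jac_def jac_iff)
    ultimately have uw: "u < w" by simp
    have "\<not> v < u" for v
    proof
      assume v: "v < u"
      then have "coef (lie_bracket (eunit v u) z) v w = coef z u w"
        using uw by (auto simp: coef_unit_lie_bracket less_imp_le)
      with comm[OF v] nz show False by (simp add: coef_simps)
    qed
    moreover have "\<not> w < v" for v
    proof
      assume v: "w < v"
      then have "coef (lie_bracket (eunit w v) z) u v = - coef z u w"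
        using uw by (auto simp: coef_unit_lie_bracket less_imp_le)
      with comm[OF v] nz show False by (simp add: coef_simps)
    qed
    ultimately show "u < w \<and> u \<in> min_elements \<and> w \<in> max_elements"
      using uw by (auto simp: min_elements_def max_elements_def)
  qed
next
  assume R: ?R
  have "z * f = 0 \<and> f * z = 0" if f: "f \<in> jac" for f
  proof -
    \<comment> \<open>A nonzero first product would need \<open>t\<close> maximal and
      \<open>t < y\<close>; a nonzero second one would need \<open>t\<close> minimal and
      \<open>x < t\<close>.\<close>
    have "coef z x t * coef f t y = 0" "coef f x t * coef z t y = 0" for x y t
    proof -
      have "coef f a b = 0" if "\<not> a < b" for a b
        using that f by (metis coef_not_le jac_iff order.order_iff_strict)
      then show "coef z x t * coef f t y = 0" "coef f x t * coef z t y = 0"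
        using R unfolding min_elements_def max_elements_def mult_eq_0_iff mem_Collect_eq by metis+
    qed
    then show ?thesis
      unfolding incidence_eq_iff times_incidence.rep_eq zero_incidence.rep_eq
      by (auto intro!: sum.neutral simp del: mult_eq_0_iff)
  qed
  moreover have "z \<in> jac" using R by (auto simp: jac_iff)
  ultimately show "z \<in> center_jac" by (simp add: center_jac_def)
qed

lemma lie_bracket_center_jac_jac:
  assumes "m \<in> center_jac" "f \<in> jac"
  shows "lie_bracket m f = 0" "lie_bracket f m = 0"
proof -
  have "m * f = f * m"
    using assms by (simp add: center_jac_def)
  then show "lie_bracket m f = 0" "lie_bracket f m = 0"
    by (simp_all add: lie_bracket_def)
qed

text \<open>If \<open>coef m z y\<close> is nonzero then \<open>z\<close> is minimal, so
  \<open>x \<le> z\<close> forces \<open>z = x\<close>: multiplication by \<open>m\<close> sees only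
  the diagonal of the other factor.\<close>

lemma coef_times_center_jac:
  assumes "m \<in> center_jac"
  shows "coef (f * m) x y = coef f x x * coef m x y"
proof -
  have "coef f x z * coef m z y = 0" if "z \<noteq> x" for z
  proof (cases "coef m z y = 0")
    case False
    with that have "\<not> x \<le> z"
      using assms by (auto simp: center_jac_iff min_elements_def order.order_iff_strict)
    then show ?thesis by (simp add: coef_not_le)
  qed auto
  then show ?thesis
    unfolding times_incidence.rep_eq by (rule sum_UNIV_single)
qed

lemma coef_center_jac_times:
  assumes "m \<in> center_jac"
  shows "coef (m * f) x y = coef m x y * coef f y y"
proof -
  have "coef m x z * coef f z y = 0" if "z \<noteq> y" for z
  proof (cases "coef m x z = 0")
    case False
    with that have "\<not> z \<le> y"
      using assms by (auto simp: center_jac_iff max_elements_def order.order_iff_strict)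
    then show ?thesis by (simp add: coef_not_le)
  qed auto
  then show ?thesis
    unfolding times_incidence.rep_eq by (rule sum_UNIV_single)
qed

lemma coef_lie_bracket_center_jac:
  "m \<in> center_jac \<Longrightarrow> coef (lie_bracket f m) x y = (coef f x x - coef f y y) * coef m x y"
  "m \<in> center_jac \<Longrightarrow> coef (lie_bracket m f) x y = (coef f y y - coef f x x) * coef m x y"
  by (simp_all add: lie_bracket_def coef_simps coef_times_center_jac coef_center_jac_times algebra_simps)

lemma lie_bracket_center_jac:
  "m \<in> center_jac \<Longrightarrow> lie_bracket m f \<in> center_jac"
  by (subst center_jac_iff) (auto simp: coef_lie_bracket_center_jac center_jac_iff)

lemma uminus_center_jac: "m \<in> center_jac \<Longrightarrow> - m \<in> center_jac"
  by (simp add: center_jac_iff coef_simps)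

lemma iscale_unit_center_jac:
  "u < v \<Longrightarrow> u \<in> min_elements \<Longrightarrow> v \<in> max_elements \<Longrightarrow> iscale a (eunit u v) \<in> center_jac"
  by (auto simp: center_jac_iff coef_simps)

text \<open>The factor \<open>m * f\<close> enters only through its diagonal, which vanishes because
  that of \<open>m\<close> does. This removes the quadratic term from conjugation by
  \<open>1 + m\<close>.\<close>

lemma center_jac_sandwich: "m \<in> center_jac \<Longrightarrow> m * f * m = 0"
  by (rule incidence_eqI)
    (auto simp: coef_times_center_jac coef_times_diag coef_simps center_jac_iff)

lemma center_jac_square: "m \<in> center_jac \<Longrightarrow> m * m = 0"
  using center_jac_sandwich[of m 1] by simp

lemma is_inverse_one_plus: "m \<in> center_jac \<Longrightarrow> is_inverse (1 + m) (1 - m)"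
  by (simp add: is_inverse_def algebra_simps center_jac_square)

lemma is_inverse_unique: "is_inverse b c \<Longrightarrow> is_inverse b d \<Longrightarrow> c = d"
  unfolding is_inverse_def by (metis mult.assoc mult_1_left mult_1_right)

lemma conj_by_one_plus:
  assumes "m \<in> center_jac"
  shows "conj_by (1 + m) f = f + lie_bracket m f"
proof -
  have "(THE c. is_inverse (1 + m) c) = 1 - m"
    using is_inverse_one_plus[OF assms] is_inverse_unique by (intro the_equality) blast+
  then have "conj_by (1 + m) f = (1 + m) * f * (1 - m)"
    by (simp only: conj_by_def)
  then show ?thesis
    using center_jac_sandwich[OF assms, of f] by (simp add: lie_bracket_def algebra_simps)
qed

text \<open>The map is conjugation by \<open>1 + m\<close>, hence multiplicative, and the same map
  for \<open>- m\<close> inverts it.\<close>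

lemma lie_automorphism_shear:
  fixes m :: "('a::{finite,order}, 'k::field) incidence"
  assumes m: "m \<in> center_jac"
  shows "lie_automorphism (\<lambda>f. f + lie_bracket m f)"
proof -
  let ?s = "\<lambda>m f. f + lie_bracket m f"
  have inv: "?s (- m) (?s m f) = f" "?s m (?s (- m) f) = f" for f
  proof -
    have "lie_bracket m (lie_bracket m f) = 0"
      using center_jac_sandwich[OF m, of f] center_jac_square[OF m]
      by (simp add: lie_bracket_def algebra_simps flip: mult.assoc) (simp add: mult.assoc)
    then show "?s (- m) (?s m f) = f" "?s m (?s (- m) f) = f"
      by simp_all
  qed
  have "bij (?s m)"
    by (rule o_bij[of "?s (- m)"]) (use inv in \<open>auto simp: fun_eq_iff\<close>)
  moreover have "Vector_Spaces.linear iscale iscale (?s m)"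
    by unfold_locales (simp_all add: incidence.scale_right_distrib)
  moreover have "?s m (lie_bracket f g) = lie_bracket (?s m f) (?s m g)" for f g
  proof -
    have s: "?s m f = (1 + m) * f * (1 - m)" for f
      using center_jac_sandwich[OF m, of f] by (simp add: lie_bracket_def algebra_simps)
    have "(1 - m) * (1 + m) = 1"
      using is_inverse_one_plus[OF m] by (simp add: is_inverse_def)
    \<comment> \<open>The inner factors \<open>1 - m\<close> and \<open>1 + m\<close> cancel, which
      gives multiplicativity.\<close>
    moreover have "?s m f * ?s m g = (1 + m) * f * ((1 - m) * (1 + m)) * g * (1 - m)" for f g
      unfolding s by (simp only: mult.assoc)
    ultimately have "?s m f * ?s m g = (1 + m) * f * g * (1 - m)" for f g
      by (simp only: mult_1_right)
    then have "?s m f * ?s m g = ?s m (f * g)" for f g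
      unfolding s by (simp only: mult.assoc)
    then have "lie_bracket (?s m f) (?s m g) = ?s m (f * g) - ?s m (g * f)"
      by (simp only: lie_bracket_def[of "?s m f"])
    then show ?thesis
      by (simp add: lie_bracket_def[of f g])
  qed
  ultimately show ?thesis
    by (simp add: lie_automorphism_def)
qed

lemma lie_automorphism_compose:
  "lie_automorphism \<phi> \<Longrightarrow> lie_automorphism \<psi> \<Longrightarrow> lie_automorphism (\<lambda>f. \<psi> (\<phi> f))"
  using Vector_Spaces.linear_compose[of iscale iscale \<phi> iscale \<psi>] bij_comp[of \<phi> \<psi>]
  by (simp add: lie_automorphism_def comp_def)

section \<open>Regular structures from normal forms\<close>

text \<open>Since \<open>[a, b]\<close> lies in \<open>jac\<close>, \<open>\<phi> c\<close> may be
  replaced by \<open>c\<close> in each term, and the ordinary Jacobi identity remains.\<close>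

lemma regular_hom_lieI:
  assumes "lie_automorphism \<phi>"
    and comm: "\<And>f x y. x \<le> y \<Longrightarrow> f \<in> jac \<Longrightarrow> lie_bracket f (\<phi> (eunit x y) - eunit x y) = 0"
  shows "regular_hom_lie \<phi>"
proof -
  interpret Vector_Spaces.linear iscale iscale \<phi>
    using assms(1) by (simp add: lie_automorphism_def)
  have "c \<in> {c. \<forall>f\<in>jac. lie_bracket f (\<phi> c - c) = 0}" for c
  proof (rule incidence_subspace_induct)
    show "incidence.subspace {c. \<forall>f\<in>jac. lie_bracket f (\<phi> c - c) = 0}"
      by (auto simp: incidence.subspace_def zero add scale algebra_simps)
  qed (use comm in auto)
  then have "lie_bracket (lie_bracket a b) (\<phi> c) = lie_bracket (lie_bracket a b) c" for a b c
    using lie_bracket_in_jac by fastforce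
  then show ?thesis
    using assms(1) by (simp add: regular_hom_lie_def) (simp add: lie_bracket_def algebra_simps)
qed

text \<open>The data of the normal form, for \<open>\<theta>\<close> the identity and \<open>\<beta> = 1 + m\<close>.\<close>

locale tau_form =
  fixes \<phi> \<tau> :: "('a::{finite,order}, 'k::field) incidence \<Rightarrow> ('a, 'k) incidence"
    and \<sigma> :: "'a \<times> 'a \<Rightarrow> 'k" and m
  assumes aut: "lie_automorphism \<tau>" and diag: "\<tau> ` diag_sub \<subseteq> diag_sub"
    and unit: "\<And>x y. x < y \<Longrightarrow> \<tau> (eunit x y) = iscale (\<sigma> (x, y)) (eunit x y)"
    and nonzero: "\<And>x y. x < y \<Longrightarrow> \<sigma> (x, y) \<noteq> 0"
    and m: "m \<in> center_jac" and \<phi>: "\<And>f. \<phi> f = \<tau> f + lie_bracket m (\<tau> f)"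
begin

sublocale t: Vector_Spaces.linear iscale iscale \<tau>
  using aut by (simp add: lie_automorphism_def)

lemma idem: "\<tau> (eunit x x) \<in> diag_sub"
proof -
  have "eunit x x \<in> diag_sub" by (simp add: diag_sub_iff coef_simps)
  then show ?thesis using diag by blast
qed

text \<open>\<open>\<tau>\<close> fixes the line of \<open>e_uv\<close>, so the diagonal element
  \<open>\<tau> e_x\<close> must act on it with the same eigenvalue as \<open>e_x\<close>.\<close>

lemma tau_weight:
  assumes "u < v"
  shows "coef (\<tau> (eunit x x)) u u - coef (\<tau> (eunit x x)) v v = weight x u v"
proof -
  have "lie_bracket (\<tau> (eunit x x)) (\<tau> (eunit u v)) = iscale (weight x u v) (\<tau> (eunit u v))"
  proof -
    have "lie_bracket (\<tau> (eunit x x)) (\<tau> (eunit u v)) = \<tau> (lie_bracket (eunit x x) (eunit u v))"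
      using aut by (simp add: lie_automorphism_def)
    then show ?thesis by (simp add: bracket_idem_unit[OF assms] t.scale)
  qed
  from coef_eqD[OF this, of u v] show ?thesis
    using nonzero[OF assms] assms lie_bracket_diag_unit[OF idem assms, of x]
    by (simp add: unit[OF assms] coef_simps less_imp_le)
qed

lemma phi_unit: "u < v \<Longrightarrow> \<phi> (eunit u v) = iscale (\<sigma> (u, v)) (eunit u v)"
  by (simp add: \<phi> unit lie_bracket_center_jac_jac[OF m unit_in_jac])

text \<open>Shows that \<open>m\<close> can be read off from \<open>\<phi>\<close>; this is the
  uniqueness of \<open>\<beta>\<close>. The factor in front of \<open>coef m u w\<close> is minus
  the weight of \<open>e_w\<close> on \<open>e_uw\<close>, that is 1.\<close>

lemma phi_idem: "u < w \<Longrightarrow> coef (\<phi> (eunit w w)) u w = coef m u w"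
  using tau_weight[of u w w] diag_subD[OF idem, of u w w]
  by (simp add: \<phi> coef_simps coef_lie_bracket_center_jac[OF m] weight_def)
    (auto simp: algebra_simps)

lemma phi_diag: "coef (\<phi> (eunit x x)) u u = coef (\<tau> (eunit x x)) u u"
  by (simp add: \<phi> coef_simps coef_lie_bracket_diag)

lemma lie_automorphism_phi: "lie_automorphism \<phi>"
proof -
  have "\<phi> = (\<lambda>f. \<tau> f + lie_bracket m (\<tau> f))" using \<phi> by auto
  then show ?thesis
    using lie_automorphism_compose[OF aut lie_automorphism_shear[OF m]] by simp
qed

lemma regular:
  assumes one: "\<And>x y. x < y \<Longrightarrow> \<not> (x \<in> min_elements \<and> y \<in> max_elements) \<Longrightarrow> \<sigma> (x, y) = 1"
  shows "regular_hom_lie \<phi>"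
proof (rule regular_hom_lieI[OF lie_automorphism_phi])
  fix f :: "('a, 'k) incidence" and x y :: 'a
  assume "x \<le> y" and f: "f \<in> jac"
  have comm: "lie_bracket f z = 0" if "z \<in> center_jac" for z
    using that f by (rule lie_bracket_center_jac_jac)
  show "lie_bracket f (\<phi> (eunit x y) - eunit x y) = 0"
  proof (cases "x = y")
    case False
    with \<open>x \<le> y\<close> have xy: "x < y" by simp
    have "\<phi> (eunit x y) - eunit x y = iscale (\<sigma> (x, y) - 1) (eunit x y)"
      by (simp add: phi_unit[OF xy] incidence.scale_left_diff_distrib)
    moreover have "lie_bracket f (iscale (\<sigma> (x, y) - 1) (eunit x y)) = 0"
      \<comment> \<open>For a minimal \<open>x\<close> and a maximal \<open>y\<close> the difference
        lies in the center; otherwise its scalar is 0.\<close>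
      using one[OF xy] comm[OF iscale_unit_center_jac[OF xy]]
      by (cases "x \<in> min_elements \<and> y \<in> max_elements") (blast, simp)
    ultimately show ?thesis by (simp only:)
  next
    case True
    define d where "d = \<tau> (eunit x x) - eunit x x"
    have d: "d \<in> diag_sub"
      using idem[of x] by (simp add: d_def diag_sub_iff coef_simps)
    \<comment> \<open>\<open>\<tau> e_x\<close> and \<open>e_x\<close> have equal weights on
      \<open>e_uv\<close>, so \<open>d\<close> has equal entries at comparable elements and
      therefore commutes with \<open>f\<close>.\<close>
    have "coef d u u = coef d v v" if "u < v" for u v
      using tau_weight[OF that, of x] that
      by (auto simp: d_def coef_simps weight_def algebra_simps split: if_splits)
    then have "f * d = d * f"
      using d f by (intro incidence_eqI)
        (auto simp: coef_diag_times coef_times_diag_sub order.order_iff_strict)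
    moreover have "\<phi> (eunit x y) - eunit x y = d + lie_bracket m (\<tau> (eunit x x))"
      using True by (simp add: \<phi> d_def)
    ultimately show ?thesis
      using comm[OF lie_bracket_center_jac[OF m]] by (simp flip: lie_bracket_zero_iff)
  qed
qed

end

section \<open>Normal forms of regular structures\<close>

locale hom_lie =
  fixes \<phi> :: "('a::{finite,order}, 'k::field) incidence \<Rightarrow> ('a, 'k) incidence"
  assumes regular: "regular_hom_lie \<phi>"
begin

lemma aut: "lie_automorphism \<phi>"
  using regular by (simp add: regular_hom_lie_def)

sublocale p: Vector_Spaces.linear iscale iscale \<phi>
  using aut by (simp add: lie_automorphism_def)

lemma phi_bracket: "\<phi> (lie_bracket f g) = lie_bracket (\<phi> f) (\<phi> g)"
  using aut by (simp add: lie_automorphism_def)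

lemma phi_eq_0D: "\<phi> f = 0 \<Longrightarrow> f = 0"
  using aut p.zero by (metis lie_automorphism_def bij_def injD)

section \<open>Commutation relations from the Hom-Jacobi identity\<close>

lemma hom_jacobi:
  "lie_bracket (lie_bracket a b) (\<phi> c) + lie_bracket (lie_bracket b c) (\<phi> a)
    + lie_bracket (lie_bracket c a) (\<phi> b) = 0"
  using regular by (simp add: regular_hom_lie_def)

text \<open>For the triple \<open>e_x\<close>, \<open>e_u\<close>, \<open>e_uv\<close> the only
  nonzero inner bracket is \<open>[e_u, e_uv] = e_uv\<close>.\<close>

lemma unit_comm_idem:
  assumes "u < v" "x \<noteq> u" "x \<noteq> v"
  shows "lie_bracket (eunit u v) (\<phi> (eunit x x)) = 0"
  using hom_jacobi[of "eunit x x" "eunit u u" "eunit u v"] assms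
  by (simp add: bracket_idem_idem bracket_idem_unit bracket_unit_idem weight_simps)

lemma unit_comm_idem_add:
  assumes "u < v"
  shows "lie_bracket (eunit u v) (\<phi> (eunit u u) + \<phi> (eunit v v)) = 0"
  using hom_jacobi[of "eunit v v" "eunit u u" "eunit u v"] assms
  by (auto simp: bracket_idem_idem bracket_idem_unit bracket_unit_idem weight_simps add.commute)

text \<open>The idempotent \<open>e_x\<close> acts on \<open>e_uv\<close> by a sign and kills
  \<open>e_pq\<close>, while \<open>e_uv\<close> and \<open>e_pq\<close> commute; one term of the
  identity survives.\<close>

lemma unit_comm_unit:
  assumes "u < v" "p < q" "v \<noteq> p" "q \<noteq> u" "x = u \<or> x = v" "x \<noteq> p" "x \<noteq> q"
  shows "lie_bracket (eunit u v) (\<phi> (eunit p q)) = 0"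
  using hom_jacobi[of "eunit x x" "eunit u v" "eunit p q"] assms
  by (auto simp: bracket_unit_unit_zero bracket_idem_unit bracket_unit_idem weight_simps)

text \<open>When \<open>e_uv\<close> and \<open>e_vw\<close> are composable, the term of
  \<open>[e_uv, e_vw] = e_uw\<close> stays. This and its mirror image \<open>unit_unit_right\<close>
  later pin down \<open>\<sigma>\<close>.\<close>

lemma unit_unit_left:
  assumes "u < v" "v < w"
  shows "lie_bracket (eunit u v) (\<phi> (eunit v w)) + lie_bracket (eunit u w) (\<phi> (eunit u u)) = 0"
  using hom_jacobi[of "eunit u u" "eunit u v" "eunit v w"] assms
  by (auto simp: bracket_unit_unit bracket_idem_unit bracket_unit_idem weight_simps)

lemma unit_unit_right:
  assumes "u < v" "v < w"
  shows "lie_bracket (eunit u w) (\<phi> (eunit w w)) + lie_bracket (eunit v w) (\<phi> (eunit u v)) = 0"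
  using hom_jacobi[of "eunit w w" "eunit u v" "eunit v w"] assms less_trans[OF assms]
  by (auto simp: bracket_unit_unit bracket_idem_unit bracket_unit_idem weight_simps)

section \<open>The support of the images of the \<open>e_uv\<close>\<close>

lemma phi_eigen:
  assumes "u < v"
  shows "lie_bracket (\<phi> (eunit x x)) (\<phi> (eunit u v)) = iscale (weight x u v) (\<phi> (eunit u v))"
  using phi_bracket[of "eunit x x" "eunit u v"] assms by (simp add: bracket_idem_unit p.scale)

text \<open>By \<open>phi_eigen\<close> with \<open>x = u\<close>, where the weight is 1, the image
  is itself a bracket.\<close>

lemma phi_unit_diag:
  assumes "u < v"
  shows "coef (\<phi> (eunit u v)) x x = 0"
  using coef_lie_bracket_diag[of "\<phi> (eunit u u)" "\<phi> (eunit u v)" x] phi_eigen[OF assms, of u]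
  by (simp add: weight_def)

lemma idem_diag_const:
  assumes "u < v" "x \<noteq> u" "x \<noteq> v"
  shows "coef (\<phi> (eunit x x)) u u = coef (\<phi> (eunit x x)) v v"
  using coef_eqD[OF unit_comm_idem[OF assms], of u v] assms(1)
  by (simp add: coef_unit_lie_bracket coef_simps less_imp_le)

text \<open>The simultaneous eigenvalues of the elements \<open>\<phi> e\<^sub>x\<close> can be read off at an inclusion-minimal
  interval of the support.\<close>

lemma minimal_support:
  assumes uv: "u < v" and nz: "coef (\<phi> (eunit u v)) p q \<noteq> 0"
    and min: "\<And>a b. p \<le> a \<Longrightarrow> a \<le> b \<Longrightarrow> b \<le> q \<Longrightarrow> coef (\<phi> (eunit u v)) a b \<noteq> 0 \<Longrightarrow> a = p \<and> b = q"
  shows "p = u \<and> q = v"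
    and "coef (\<phi> (eunit x x)) p p - coef (\<phi> (eunit x x)) q q = weight x u v"
proof -
  let ?g = "\<phi> (eunit u v)"
  have "p \<le> q" using nz coef_not_le by blast
  moreover have "p \<noteq> q" using nz phi_unit_diag[OF uv] by auto
  ultimately have pq: "p < q" by simp
  have w: "coef (\<phi> (eunit x x)) p p - coef (\<phi> (eunit x x)) q q = weight x u v" for x
  proof -
    let ?f = "\<phi> (eunit x x)"
    \<comment> \<open>A nonzero term would put the smaller interval from \<open>z\<close> to
      \<open>q\<close> into the support of \<open>?g\<close>, against minimality.\<close>
    have "coef ?f p z * coef ?g z q = 0" if "z \<noteq> p" for z
      using that min[of z q] coef_not_le[of p z ?f] coef_not_le[of z q ?g] by auto
    then have "coef (?f * ?g) p q = coef ?f p p * coef ?g p q"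
      unfolding times_incidence.rep_eq by (rule sum_UNIV_single)
    moreover have "coef ?g p z * coef ?f z q = 0" if "z \<noteq> q" for z
      using that min[of p z] coef_not_le[of z q ?f] coef_not_le[of p z ?g] by auto
    then have "coef (?g * ?f) p q = coef ?g p q * coef ?f q q"
      unfolding times_incidence.rep_eq by (rule sum_UNIV_single)
    ultimately have "coef (lie_bracket ?f ?g) p q = (coef ?f p p - coef ?f q q) * coef ?g p q"
      by (simp add: lie_bracket_def coef_simps algebra_simps)
    then show ?thesis
      using nz by (simp add: phi_eigen[OF uv] coef_simps)
  qed
  show "coef (\<phi> (eunit x x)) p p - coef (\<phi> (eunit x x)) q q = weight x u v" by (rule w)
  \<comment> \<open>The weight of \<open>e_x\<close> on \<open>e_uv\<close> is nonzero for
    \<open>x\<close> in \<open>{u, v}\<close>, whereas \<open>\<phi> e_x\<close> has equal entries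
    at \<open>p\<close> and \<open>q\<close> unless \<open>x\<close> is one of them. So
    \<open>{u, v}\<close> lies in \<open>{p, q}\<close>, and the order fixes the matching.\<close>
  have "x = p \<or> x = q" if "x = u \<or> x = v" for x
  proof (rule ccontr)
    assume "\<not> (x = p \<or> x = q)"
    then have "weight x u v = (0::'k)"
      using w[of x] idem_diag_const[OF pq, of x] by simp
    then show False using that by (auto simp: weight_def split: if_splits)
  qed
  then show "p = u \<and> q = v"
    using pq uv by (metis less_asym less_irrefl)
qed

text \<open>Every interval of the support contains a minimal one, which can only be the interval
  from \<open>u\<close> to \<open>v\<close>.\<close>

lemma phi_unit_support:
  assumes "u < v" "coef (\<phi> (eunit u v)) p q \<noteq> 0"
  shows "p \<le> u \<and> v \<le> q"
  using minimal_support_exists[OF assms(2)] minimal_support(1)[OF assms(1)] by metis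

lemma phi_unit_leading:
  assumes uv: "u < v"
  shows "coef (\<phi> (eunit u v)) u v \<noteq> 0"
    and idem_weight: "coef (\<phi> (eunit x x)) u u - coef (\<phi> (eunit x x)) v v = weight x u v"
proof -
  have "\<phi> (eunit u v) \<noteq> 0"
    using phi_eq_0D[of "eunit u v"] unit_nonzero[OF less_imp_le[OF uv]] by blast
  then obtain p q where "coef (\<phi> (eunit u v)) p q \<noteq> 0"
    by (auto simp: incidence_eq_iff coef_simps)
  from minimal_support_exists[OF this] obtain a b where ab: "coef (\<phi> (eunit u v)) a b \<noteq> 0"
    "\<And>c d. a \<le> c \<Longrightarrow> c \<le> d \<Longrightarrow> d \<le> b \<Longrightarrow> coef (\<phi> (eunit u v)) c d \<noteq> 0 \<Longrightarrow> c = a \<and> d = b"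
    by blast
  from minimal_support[OF uv ab]
  show "coef (\<phi> (eunit u v)) u v \<noteq> 0"
    "coef (\<phi> (eunit x x)) u u - coef (\<phi> (eunit x x)) v v = weight x u v"
    using ab(1) by auto
qed

text \<open>If \<open>a < v\<close>, bracketing with \<open>e_av\<close> carries the coefficient at
  \<open>(v, w)\<close> to \<open>(a, w)\<close>, where the relations force it to vanish. The
  argument for \<open>w < b\<close> is dual.\<close>

lemma phi_unit_extra_support:
  assumes pq: "p < q" and nz: "coef (\<phi> (eunit p q)) v w \<noteq> 0" and ne: "(v, w) \<noteq> (p, q)"
  shows "v \<in> min_elements" "w \<in> max_elements"
proof -
  let ?g = "\<phi> (eunit p q)"
  have le: "v \<le> p" "q \<le> w" using phi_unit_support[OF pq nz] by auto
  then have strict: "v < p \<or> q < w" "v < q" "p < w" "v < w"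
    using ne pq by (auto simp: order.order_iff_strict)
  then have neq: "v \<noteq> q" "q \<noteq> v" "p \<noteq> w" "w \<noteq> p" "v \<noteq> w" "w \<noteq> v" "p \<noteq> q" "q \<noteq> p"
    using pq by auto
  have "\<not> a < v" for a
  proof
    assume a: "a < v"
    show False
    proof (cases "v = p")
      case False
      then have "lie_bracket (eunit a v) ?g = 0"
        using a le pq by (intro unit_comm_unit[where x = a]) auto
      from coef_eqD[OF this, of a w] show False
        using a neq nz by (simp add: coef_unit_lie_bracket coef_simps less_imp_le)
    next
      case True
      \<comment> \<open>Now \<open>e_av\<close> and \<open>e_pq\<close> are composable, so
        \<open>unit_comm_unit\<close> does not apply. \<open>unit_unit_left\<close> does, once its
        second term is shown to vanish at \<open>(a, w)\<close>.\<close>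
      then have "q < w" using strict by auto
      have "lie_bracket (eunit p q) (\<phi> (eunit a a)) = 0"
        using a True pq by (intro unit_comm_idem) auto
      from coef_eqD[OF this, of p w] have "coef (\<phi> (eunit a a)) q w = 0"
        using pq \<open>q < w\<close> less_imp_neq[OF \<open>q < w\<close>] by (simp add: coef_unit_lie_bracket coef_simps less_imp_le)
      then show False
        using coef_eqD[OF unit_unit_left[OF a[unfolded True] pq], of a w] a True pq less_imp_neq[OF \<open>q < w\<close>] strict neq nz
        by (simp add: coef_unit_lie_bracket coef_simps less_imp_le)
    qed
  qed
  then show "v \<in> min_elements" by (simp add: min_elements_def)
  have "\<not> w < b" for b
  proof
    assume b: "w < b"
    show False
    proof (cases "w = q")
      case False
      then have "lie_bracket (eunit w b) ?g = 0"
        using b le pq by (intro unit_comm_unit[where x = b]) auto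
      from coef_eqD[OF this, of v b] show False
        using b neq nz by (simp add: coef_unit_lie_bracket coef_simps less_imp_le)
    next
      case True
      then have "v < p" using strict by auto
      have "lie_bracket (eunit p q) (\<phi> (eunit b b)) = 0"
        using b True pq by (intro unit_comm_idem) auto
      from coef_eqD[OF this, of v q] have "coef (\<phi> (eunit b b)) v p = 0"
        using pq \<open>v < p\<close> less_imp_neq[OF \<open>v < p\<close>] by (simp add: coef_unit_lie_bracket coef_simps less_imp_le)
      then show False
        using coef_eqD[OF unit_unit_right[OF pq b[unfolded True]], of v b] b True pq less_imp_neq[OF \<open>v < p\<close>] strict neq nz
        by (simp add: coef_unit_lie_bracket coef_simps less_imp_le)
    qed
  qed
  then show "w \<in> max_elements" by (simp add: max_elements_def)
qed

text \<open>Up to the multiple of \<open>e_pq\<close> the image lies in the center of the radical,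
  on which each \<open>\<phi> e_x\<close> acts by scalars. The eigenvalue equations for
  \<open>x = p\<close> and \<open>x = q\<close>, compared at \<open>(v, w)\<close>, then exclude an
  extra coefficient.\<close>

lemma phi_unit_extra_zero:
  assumes pq: "p < q" and ne: "(v, w) \<noteq> (p, q)"
  shows "coef (\<phi> (eunit p q)) v w = 0"
proof (rule ccontr)
  let ?g = "\<phi> (eunit p q)" and ?f = "\<lambda>x. \<phi> (eunit x x)"
  assume nz: "coef ?g v w \<noteq> 0"
  define s where "s = coef ?g p q"
  define h where "h = ?g - iscale s (eunit p q)"
  have s: "s \<noteq> 0" using phi_unit_leading(1)[OF pq] by (simp add: s_def)
  have le: "v \<le> p" "q \<le> w" using phi_unit_support[OF pq nz] by auto
  then have strict: "v < p \<or> q < w" "v < q" "p < w" "v < w"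
    using ne pq by (auto simp: order.order_iff_strict)
  then have neq: "v \<noteq> q" "q \<noteq> v" "p \<noteq> w" "w \<noteq> p" "v \<noteq> w" "w \<noteq> v" "p \<noteq> q" "q \<noteq> p"
    using pq by auto
  have h: "h \<in> center_jac"
    unfolding center_jac_iff
  proof (intro allI impI)
    fix a b assume "coef h a b \<noteq> 0"
    then have ab: "(a, b) \<noteq> (p, q)" "coef ?g a b \<noteq> 0"
      using pq by (auto simp: h_def coef_simps s_def split: if_splits)
    with phi_unit_support[OF pq this(2)] pq phi_unit_extra_support[OF pq this(2,1)]
    show "a < b \<and> a \<in> min_elements \<and> b \<in> max_elements"
      by (metis order.strict_trans1 order.strict_trans2)
  qed
  have g: "?g = iscale s (eunit p q) + h" by (simp add: h_def)
  have hvw: "coef h v w = coef ?g v w"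
    using ne by (auto simp: h_def coef_simps)
  \<comment> \<open>The coefficient at \<open>(v, w)\<close> of \<open>phi_eigen\<close> after
    splitting \<open>?g\<close> into its leading term and \<open>h\<close>.\<close>
  have key: "s * ((if w = q then coef (?f x) v p else 0) - (if v = p then coef (?f x) q w else 0))
      + weight x v w * coef ?g v w = weight x p q * coef ?g v w" for x
  proof -
    have "coef (lie_bracket (?f x) (iscale s (eunit p q) + h)) v w = weight x p q * coef ?g v w"
      using phi_eigen[OF pq, of x] by (simp add: coef_simps flip: g)
    then show ?thesis
      using idem_weight[OF strict(4), of x] pq
      by (simp add: coef_simps coef_lie_bracket_center_jac[OF h] coef_lie_bracket_unit hvw less_imp_le)
  qed
  have sum: "coef (lie_bracket (eunit p q) (?f p + ?f q)) a b = 0" for a b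
    using unit_comm_idem_add[OF pq] by (simp only: coef_simps)
  consider "v \<noteq> p" "w \<noteq> q" | "v < p" "w = q" | "v = p" "q < w"
    using strict by (auto simp: order.order_iff_strict)
  then show False
  proof cases
    case 1
    then show False using key[of p] nz neq pq by (auto simp: weight_simps)
  next
    case 2
    \<comment> \<open>For \<open>x = q = w\<close> the two weights agree and cancel in
      \<open>key\<close>. \<open>sum\<close> carries the vanishing over to \<open>?f p\<close>, and
      \<open>key\<close> for \<open>x = p\<close> then has weights 0 and 1. The last case is the
      mirror image.\<close>
    have "coef (?f q) v p = 0"
      using key[of q] 2 neq less_imp_neq[OF 2(1)] s pq by (auto simp: weight_def)
    moreover have "coef (?f p) v p + coef (?f q) v p = 0"
      using sum[of v q] 2 neq less_imp_neq[OF 2(1)] pq by (auto simp: coef_unit_lie_bracket coef_simps less_imp_le neg_eq_iff_add_eq_0)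
    ultimately show False
      using key[of p] 2 neq less_imp_neq[OF 2(1)] nz pq by (auto simp: weight_def)
  next
    case 3
    have "coef (?f p) q w = 0"
      using key[of p] 3 neq less_imp_neq[OF 3(2)] s pq by (auto simp: weight_def)
    moreover have "coef (?f p) q w + coef (?f q) q w = 0"
      using sum[of p w] 3 neq less_imp_neq[OF 3(2)] pq by (auto simp: coef_unit_lie_bracket coef_simps less_imp_le neg_eq_iff_add_eq_0)
    ultimately show False
      using key[of q] 3 neq less_imp_neq[OF 3(2)] nz pq by (auto simp: weight_def)
  qed
qed

section \<open>The scalars by which \<open>\<phi>\<close> acts on the \<open>e_uv\<close>\<close>

definition \<sigma> :: "'a \<times> 'a \<Rightarrow> 'k" where
  "\<sigma> = (\<lambda>(u, v)\<in>strict_pairs. coef (\<phi> (eunit u v)) u v)"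

lemma phi_unit: "u < v \<Longrightarrow> \<phi> (eunit u v) = iscale (\<sigma> (u, v)) (eunit u v)"
  using phi_unit_extra_zero[of u v]
  by (auto simp: incidence_eq_iff coef_simps \<sigma>_def strict_pairs_def)

lemma sigma_nonzero: "u < v \<Longrightarrow> \<sigma> (u, v) \<noteq> 0"
  using phi_unit_leading(1)[of u v] by (simp add: \<sigma>_def strict_pairs_def)

lemma bracket_phi_idem_unit:
  assumes "u < v"
  shows "lie_bracket (\<phi> (eunit x x)) (eunit u v) = iscale (weight x u v) (eunit u v)"
proof -
  have "iscale (\<sigma> (u, v)) (lie_bracket (\<phi> (eunit x x)) (eunit u v))
      = iscale (\<sigma> (u, v)) (iscale (weight x u v) (eunit u v))"
    using phi_eigen[OF assms, of x] by (simp add: phi_unit[OF assms] mult.commute)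
  then show ?thesis
    using sigma_nonzero[OF assms] by (simp only: incidence.scale_cancel_left) simp
qed

lemma sigma_mult:
  assumes "u < v" "v < w"
  shows "\<sigma> (u, w) = \<sigma> (u, v) * \<sigma> (v, w)"
proof -
  have "u < w" using assms by simp
  have "iscale (\<sigma> (u, w)) (eunit u w :: ('a, 'k) incidence) = iscale (\<sigma> (u, v) * \<sigma> (v, w)) (eunit u w)"
    using phi_bracket[of "eunit u v" "eunit v w"] assms
    by (simp add: bracket_unit_unit phi_unit \<open>u < w\<close> mult.commute)
  from coef_eqD[OF this, of u w] show ?thesis
    using \<open>u < w\<close> by (simp add: coef_simps less_imp_le)
qed

text \<open>For \<open>a < u\<close> the relation \<open>unit_unit_left\<close> on
  \<open>a < u < v\<close> compares \<open>\<sigma> (u, v)\<close> times \<open>e_av\<close> with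
  the weight-one multiple \<open>[\<phi> e_a, e_av] = e_av\<close>. For \<open>v < b\<close> the
  argument is dual.\<close>

lemma sigma_one:
  assumes uv: "u < v" and nm: "\<not> (u \<in> min_elements \<and> v \<in> max_elements)"
  shows "\<sigma> (u, v) = 1"
proof -
  consider a where "a < u" | b where "v < b"
    using nm by (auto simp: min_elements_def max_elements_def)
  then show ?thesis
  proof cases
    case 1
    then have av: "a < v" using uv by simp
    have "lie_bracket (eunit a v) (\<phi> (eunit a a)) = - eunit a v"
      by (subst lie_bracket_skew) (simp add: bracket_phi_idem_unit[OF av] weight_def)
    then have "iscale (\<sigma> (u, v)) (eunit a v :: ('a, 'k) incidence) = eunit a v"
      using unit_unit_left[OF 1 uv] by (simp add: phi_unit[OF uv] bracket_unit_unit[OF 1 uv])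
    from coef_eqD[OF this, of a v] show ?thesis
      using av by (simp add: coef_simps less_imp_le)
  next
    case 2
    then have ub: "u < b" using uv by simp
    have "lie_bracket (eunit u b) (\<phi> (eunit b b)) = eunit u b"
      by (subst lie_bracket_skew) (use ub in \<open>auto simp: bracket_phi_idem_unit[OF ub] weight_def\<close>)
    moreover have "lie_bracket (eunit v b) (eunit u v) = - (eunit u b :: ('a, 'k) incidence)"
      by (subst lie_bracket_skew) (simp add: bracket_unit_unit[OF uv 2])
    ultimately have "iscale (\<sigma> (u, v)) (eunit u b :: ('a, 'k) incidence) = eunit u b"
      using unit_unit_right[OF uv 2] by (simp add: phi_unit[OF uv])
    from coef_eqD[OF this, of u b] show ?thesis
      using ub by (simp add: coef_simps less_imp_le)
  qed
qed

section \<open>The images of the idempotents\<close>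

lemma phi_idem_support:
  assumes "coef (\<phi> (eunit x x)) u w \<noteq> 0" "u \<noteq> w"
  shows "u < w" "u \<in> min_elements" "w \<in> max_elements"
proof -
  show uw: "u < w" using assms coef_not_le by (metis order.order_iff_strict)
  have "\<not> a < u" for a
  proof
    assume a: "a < u"
    \<comment> \<open>At \<open>(a, w)\<close> the multiple of \<open>e_au\<close> vanishes and the
      bracket contributes minus the coefficient at \<open>(u, w)\<close>.\<close>
    from coef_eqD[OF bracket_phi_idem_unit[OF a], of x a w] show False
      using a uw assms by (simp add: coef_lie_bracket_unit coef_simps less_imp_le)
  qed
  then show "u \<in> min_elements" by (simp add: min_elements_def)
  have "\<not> w < b" for b
  proof
    assume b: "w < b"
    from coef_eqD[OF bracket_phi_idem_unit[OF b], of x u b] show False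
      using b uw assms by (simp add: coef_lie_bracket_unit coef_simps less_imp_le)
  qed
  then show "w \<in> max_elements" by (simp add: max_elements_def)
qed

text \<open>Column \<open>w\<close> is the off-diagonal part of column \<open>w\<close> of
  \<open>\<phi> e_w\<close>, the choice dictated by \<open>phi_idem\<close> for normal
  forms.\<close>

definition m :: "('a, 'k) incidence" where
  "m = (\<Sum>w\<in>UNIV. \<phi> (eunit w w) * eunit w w - iscale (coef (\<phi> (eunit w w)) w w) (eunit w w))"

lemma coef_m: "coef m u w = (if u = w then 0 else coef (\<phi> (eunit w w)) u w)"
proof -
  have "coef (\<phi> (eunit z z) * eunit z z - iscale (coef (\<phi> (eunit z z)) z z) (eunit z z)) u w
      = (if z = w then if u = w then 0 else coef (\<phi> (eunit w w)) u w else 0)" for z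
    by (auto simp: coef_simps coef_times_unit)
  then show ?thesis by (simp add: m_def coef_sum)
qed

lemma m_center: "m \<in> center_jac"
  using phi_idem_support by (auto simp: center_jac_iff coef_m split: if_splits)

text \<open>The images of \<open>e_x\<close> and \<open>e_w\<close> commute because the idempotents
  do; the coefficient of their bracket at \<open>(u, w)\<close> expresses \<open>\<phi> e_x\<close>
  through \<open>\<phi> e_w\<close>, that is through \<open>m\<close>.\<close>

lemma phi_idem_offdiag:
  assumes uw: "u \<noteq> w"
  shows "coef (\<phi> (eunit x x)) u w = - weight x u w * coef m u w"
proof (cases "u < w")
  case False
  with uw have "\<not> u \<le> w" by simp
  then show ?thesis by (simp add: coef_not_le)
next
  case True
  define off where "off x = \<phi> (eunit x x) - diag_part (\<phi> (eunit x x))" for x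
  have od: "coef (off x) a b = (if a = b then 0 else coef (\<phi> (eunit x x)) a b)" for a b x
    using diag_subD[OF diag_part_in, of a b "\<phi> (eunit x x)"] jacD[OF jac_part_in, of "\<phi> (eunit x x)" a]
    by (auto simp: off_def coef_simps jac_part_def)
  have oc: "off x \<in> center_jac" for x
    using phi_idem_support[of x] by (auto simp: center_jac_iff od split: if_splits)
  \<comment> \<open>Both images are split into diagonal and off-diagonal parts. Diagonal parts
    commute, as do the central off-diagonal ones, so only the mixed terms remain;
    \<open>idem_weight\<close> gives their factors.\<close>
  have br: "coef (lie_bracket (\<phi> (eunit x x)) (\<phi> (eunit y y))) u w
      = weight x u w * coef (off y) u w - weight y u w * coef (off x) u w" for x y
  proof -
    define c where "c x = diag_part (\<phi> (eunit x x))" for x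
    have c: "c x \<in> diag_sub" "\<phi> (eunit x x) = c x + off x" for x
      by (simp_all add: c_def off_def diag_part_in)
    have cc: "coef (c x) a a = coef (\<phi> (eunit x x)) a a" for x a
      using c(2)[of x] od[of x a a] by (simp add: coef_simps)
    have "coef (lie_bracket (c x) (c y)) u w = 0"
      using c(1) uw by (simp add: lie_bracket_def coef_simps coef_diag_times diag_subD)
    moreover have "lie_bracket (off x) (off y) = 0"
      using oc by (intro lie_bracket_center_jac_jac) (auto simp: center_jac_def)
    ultimately show ?thesis
      using idem_weight[OF True, of x] idem_weight[OF True, of y] oc
      by (simp add: c(2) coef_simps coef_lie_bracket_center_jac flip: cc)
        (simp add: od coef_simps algebra_simps)
  qed
  have "weight x u w * coef (off w) u w - weight w u w * coef (off x) u w = 0"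
    using br[of x w] by (simp add: bracket_idem_idem coef_simps p.zero flip: phi_bracket)
  then show ?thesis
    using uw by (auto simp: od coef_m weight_def add_eq_0_iff split: if_splits)
qed

section \<open>The factor of \<open>\<phi>\<close> that preserves the diagonal\<close>

definition \<tau> :: "('a, 'k) incidence \<Rightarrow> ('a, 'k) incidence" where
  "\<tau> f = \<phi> f + lie_bracket (- m) (\<phi> f)"

lemma tau_aut: "lie_automorphism \<tau>"
  using lie_automorphism_compose[OF aut lie_automorphism_shear[OF uminus_center_jac[OF m_center]]]
  unfolding \<tau>_def[abs_def] .

lemma tau_unit: "u < v \<Longrightarrow> \<tau> (eunit u v) = iscale (\<sigma> (u, v)) (eunit u v)"
  by (simp add: \<tau>_def phi_unit lie_bracket_center_jac_jac[OF m_center unit_in_jac])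

lemma tau_diag: "\<tau> ` diag_sub \<subseteq> diag_sub"
proof -
  interpret t: Vector_Spaces.linear iscale iscale \<tau>
    using tau_aut by (simp add: lie_automorphism_def)
  have "\<tau> (eunit x x) \<in> diag_sub" for x
    unfolding diag_sub_iff
  proof (intro allI impI)
    fix u w :: 'a assume uw: "u \<noteq> w"
    show "coef (\<tau> (eunit x x)) u w = 0"
    proof (cases "u < w")
      case True
      \<comment> \<open>The bracket with \<open>- m\<close> contributes the weight times
        \<open>coef m u w\<close>, exactly cancelling \<open>phi_idem_offdiag\<close>.\<close>
      then show ?thesis
        using idem_weight[OF True, of x]
        by (simp add: \<tau>_def coef_simps coef_lie_bracket_center_jac[OF m_center] phi_idem_offdiag[OF uw])
          (simp add: algebra_simps flip: distrib_left)
    next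
      case False
      with uw have "\<not> u \<le> w" by simp
      then show ?thesis by (simp add: coef_not_le)
    qed
  qed
  then have "range (\<lambda>x. eunit x x) \<subseteq> \<tau> -` diag_sub" by auto
  moreover have "incidence.subspace (\<tau> -` diag_sub)"
    by (rule t.subspace_vimage) (simp add: diag_sub_def incidence.subspace_span)
  ultimately have "diag_sub \<subseteq> \<tau> -` diag_sub"
    by (subst diag_sub_def) (rule incidence.span_minimal)
  then show ?thesis by auto
qed

text \<open>The shears by \<open>m\<close> and \<open>- m\<close> are mutually inverse, since
  \<open>m * m\<close> and \<open>m * f * m\<close> vanish.\<close>

lemma phi_tau: "\<phi> f = \<tau> f + lie_bracket m (\<tau> f)"
  using conj_by_one_plus[OF m_center] center_jac_sandwich[OF m_center] center_jac_square[OF m_center]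
  by (simp add: \<tau>_def lie_bracket_def algebra_simps)
    (simp add: mult.assoc[symmetric])

end

section \<open>The identity as \<open>\<theta>\<close>, and the trace condition\<close>

lemma monotone_on_max_chains_id:
  "monotone_on_max_chains (restrict id strict_basis)"
  unfolding monotone_on_max_chains_def
proof (intro allI impI)
  fix us :: "'a list" assume us: "maximal_chain_list us"
  have "restrict id strict_basis (eunit (us ! i) (us ! j)) = eunit (us ! i) (us ! j)"
    if "i < j \<and> j < length us" for i j
  proof -
    have "us ! i < us ! j"
      using us that by (simp add: maximal_chain_list_def sorted_wrt_iff_nth_less)
    then show ?thesis by (simp add: unit_in_strict_basis)
  qed
  then show "\<exists>vs. maximal_chain_list vs \<and> length vs = length us \<and>
         ((\<forall>i j. i < j \<and> j < length us \<longrightarrow>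
             restrict id strict_basis (eunit (us ! i) (us ! j)) = eunit (vs ! i) (vs ! j)) \<or>
          (\<forall>i j. i < j \<and> j < length us \<longrightarrow>
             restrict id strict_basis (eunit (us ! i) (us ! j)) =
               eunit (vs ! (length us - 1 - j)) (vs ! (length us - 1 - i))))"
    using us by blast
qed

text \<open>The sign alternative never occurs: \<open>e_yz * e_xy\<close> is 0 and
  \<open>e_xz\<close> is not.\<close>

lemma compatible_with_id:
  fixes \<sigma> :: "'a::{finite,order} \<times> 'a \<Rightarrow> 'k::field"
  assumes "\<And>x y z. x < y \<Longrightarrow> y < z \<Longrightarrow> \<sigma> (x, z) = \<sigma> (x, y) * \<sigma> (y, z)"
  shows "compatible_with (restrict id strict_basis) \<sigma>"
  unfolding compatible_with_def
proof (intro allI impI conjI)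
  fix x y z :: 'a assume xyz: "x < y \<and> y < z"
  then show "\<sigma> (x, z) = \<sigma> (x, y) * \<sigma> (y, z)" using assms by blast
  have "eunit x y \<in> (strict_basis :: ('a, 'k) incidence set)"
    "eunit y z \<in> (strict_basis :: ('a, 'k) incidence set)"
    "eunit x z \<in> (strict_basis :: ('a, 'k) incidence set)"
    using xyz by (auto intro: unit_in_strict_basis order.strict_trans)
  moreover have "eunit y z * eunit x y = (0 :: ('a, 'k) incidence)"
    using xyz by (auto simp: unit_times_unit less_imp_le)
  moreover have "eunit x z \<noteq> (0 :: ('a, 'k) incidence)"
    using xyz by (intro unit_nonzero) auto
  moreover assume "restrict id strict_basis (eunit x z :: ('a, 'k) incidence)
    = restrict id strict_basis (eunit y z) * restrict id strict_basis (eunit x y)"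
  ultimately show "\<sigma> (x, z) = - (\<sigma> (x, y) * \<sigma> (y, z))"
    by simp
qed

text \<open>The trace \<open>sum_list cs\<close> is a diagonal entry of \<open>\<phi> 1\<close>, which is central and hence a scalar
  because the poset is connected.\<close>

lemma lie_automorphism_one_coef:
  fixes \<phi> :: "('a::{finite,order}, 'k::field) incidence \<Rightarrow> ('a, 'k) incidence"
  assumes aut: "lie_automorphism \<phi>" and conn: "connected_poset (UNIV :: 'a set)"
  shows "coef (\<phi> 1) x x \<noteq> 0"
proof
  interpret Vector_Spaces.linear iscale iscale \<phi>
    using aut by (simp add: lie_automorphism_def)
  have comm: "lie_bracket (\<phi> 1) f = 0" for f
  proof -
    obtain g where "f = \<phi> g"
      using aut by (metis lie_automorphism_def bij_def surjD)
    moreover have "\<phi> (lie_bracket 1 g) = lie_bracket (\<phi> 1) (\<phi> g)"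
      using aut by (simp add: lie_automorphism_def)
    ultimately show ?thesis
      by (simp add: lie_bracket_def zero)
  qed
  \<comment> \<open>Commuting with idempotents makes \<open>\<phi> 1\<close> diagonal; commuting
    with the \<open>e_uv\<close> makes its entries agree along comparabilities.\<close>
  have off: "coef (\<phi> 1) u v = 0" if "u \<noteq> v" for u v
    using that coef_eqD[OF comm[of "eunit v v"], of u v]
    by (simp add: coef_lie_bracket_unit coef_simps)
  have step: "coef (\<phi> 1) u u = coef (\<phi> 1) v v" if "u < v" for u v
    using that coef_eqD[OF comm[of "eunit u v"], of u v]
    by (simp add: coef_lie_bracket_unit coef_simps less_imp_le)
  have const: "coef (\<phi> 1) u u = coef (\<phi> 1) v v" for u v
  proof -
    have "(\<lambda>u v. u \<in> (UNIV::'a set) \<and> v \<in> (UNIV::'a set) \<and> (u \<le> v \<or> v \<le> u))\<^sup>*\<^sup>* u v"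
      using conn by (auto simp: connected_poset_def)
    then show ?thesis
      by induction (use step in \<open>auto simp: order.order_iff_strict\<close>)
  qed
  assume "coef (\<phi> 1) x x = 0"
  then have "\<phi> 1 = \<phi> 0"
    unfolding zero incidence_eq_iff by (metis const off zero_incidence.rep_eq)
  then show False
    using aut by (metis lie_automorphism_def bij_def injD zero_neq_one)
qed

lemma one_eq_sum_idem: "(1 :: ('a::{finite,order}, 'k::field) incidence) = (\<Sum>x\<in>UNIV. eunit x x)"
proof -
  have "coef (eunit x x :: ('a, 'k) incidence) u v = (if x = u then if u = v then 1 else 0 else 0)" for x u v
    by (auto simp: coef_simps)
  then show ?thesis
    by (simp add: incidence_eq_iff coef_sum one_incidence.rep_eq)
qed

theorem theorem2p11:
  fixes xs :: "'a::{finite,order} list"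
    and \<phi> :: "('a, 'k::field) incidence \<Rightarrow> ('a, 'k) incidence"
  assumes "distinct xs" and "set xs = UNIV"
    and "connected_poset (UNIV :: 'a set)"
    and "card (UNIV :: 'a set) > 1"
    and "lie_automorphism \<phi>"
  shows "let P = (\<lambda>\<beta> \<theta> \<sigma> cs.
      \<beta> \<in> unit_group \<and>
      \<theta> \<in> strict_basis \<rightarrow>\<^sub>E strict_basis \<and> bij_betw \<theta> strict_basis strict_basis \<and>
      monotone_on_max_chains \<theta> \<and>
      \<sigma> \<in> strict_pairs \<rightarrow>\<^sub>E UNIV - {0} \<and> compatible_with \<theta> \<sigma> \<and>
      length cs = length xs \<and> sum_list cs \<noteq> 0 \<and>
      tau_exists xs \<theta> \<sigma> cs \<and> \<phi> = conj_by \<beta> \<circ> tau xs \<theta> \<sigma> cs \<and>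
      (\<forall>b\<in>strict_basis. \<theta> b = b) \<and>
      (\<forall>x y. x < y \<and> \<not> (x \<in> min_elements \<and> y \<in> max_elements) \<longrightarrow> \<sigma> (x, y) = 1) \<and>
      diag_part \<beta> = 1 \<and> jac_part \<beta> \<in> center_jac)
    in (regular_hom_lie \<phi> \<longleftrightarrow> (\<exists>\<beta> \<theta> \<sigma> cs. P \<beta> \<theta> \<sigma> cs)) \<and>
       (\<forall>\<beta> \<theta> \<sigma> cs \<beta>' \<theta>' \<sigma>' cs'. P \<beta> \<theta> \<sigma> cs \<and> P \<beta>' \<theta>' \<sigma>' cs' \<longrightarrow>
          \<beta> = \<beta>' \<and> \<theta> = \<theta>' \<and> \<sigma> = \<sigma>' \<and> cs = cs')"
  unfolding Let_def
proof (intro conjI allI impI)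
  define P where "P = (\<lambda>\<beta> \<theta> \<sigma> cs.
      \<beta> \<in> unit_group \<and>
      \<theta> \<in> strict_basis \<rightarrow>\<^sub>E strict_basis \<and> bij_betw \<theta> strict_basis strict_basis \<and>
      monotone_on_max_chains \<theta> \<and>
      \<sigma> \<in> strict_pairs \<rightarrow>\<^sub>E UNIV - {0} \<and> compatible_with \<theta> \<sigma> \<and>
      length cs = length xs \<and> sum_list cs \<noteq> 0 \<and>
      tau_exists xs \<theta> \<sigma> cs \<and> \<phi> = conj_by \<beta> \<circ> tau xs \<theta> \<sigma> cs \<and>
      (\<forall>b\<in>strict_basis. \<theta> b = b) \<and>
      (\<forall>x y. x < y \<and> \<not> (x \<in> min_elements \<and> y \<in> max_elements) \<longrightarrow> \<sigma> (x, y) = 1) \<and>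
      diag_part \<beta> = 1 \<and> jac_part \<beta> \<in> center_jac)"
  note xs = assms(2) and conn = assms(3)
  \<comment> \<open>Used both for regularity of a normal form and for the uniqueness of its
    data.\<close>
  have form: "tau_form \<phi> (tau xs \<theta> \<sigma> cs) \<sigma> (jac_part \<beta>)"
    and is_tau: "is_tau xs \<theta> \<sigma> cs (tau xs \<theta> \<sigma> cs)"
    if "P \<beta> \<theta> \<sigma> cs" for \<beta> \<theta> \<sigma> cs
  proof -
    have \<theta>: "bij_betw \<theta> strict_basis strict_basis" and id: "\<forall>b\<in>strict_basis. \<theta> b = b"
      and \<sigma>: "\<And>x y. x < y \<Longrightarrow> \<sigma> (x, y) \<noteq> 0"
      and ex: "tau_exists xs \<theta> \<sigma> cs" and \<phi>: "\<phi> = conj_by \<beta> \<circ> tau xs \<theta> \<sigma> cs"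
      and \<beta>: "diag_part \<beta> = 1" "jac_part \<beta> \<in> center_jac"
      using that by (auto simp: P_def strict_pairs_def)
    from ex obtain \<tau>' where \<tau>': "is_tau xs \<theta> \<sigma> cs \<tau>'"
      by (auto simp: tau_exists_def)
    show *: "is_tau xs \<theta> \<sigma> cs (tau xs \<theta> \<sigma> cs)"
      unfolding tau_def
      by (rule theI[where P = "is_tau xs \<theta> \<sigma> cs", OF \<tau>'])
        (rule is_tau_unique[where \<sigma> = \<sigma>, OF xs conn \<theta> \<sigma> _ \<tau>'])
    have "\<beta> = 1 + jac_part \<beta>"
      using \<beta>(1) by (simp add: jac_part_def)
    then have "conj_by \<beta> f = f + lie_bracket (jac_part \<beta>) f" for f
      using conj_by_one_plus[OF \<beta>(2)] by metis
    then show "tau_form \<phi> (tau xs \<theta> \<sigma> cs) \<sigma> (jac_part \<beta>)"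
      using * \<beta>(2) \<sigma> id unfolding \<phi> by unfold_locales (auto simp: is_tau_def unit_in_strict_basis)
  qed
  have "\<exists>\<beta> \<theta> \<sigma> cs. P \<beta> \<theta> \<sigma> cs" if reg: "regular_hom_lie \<phi>"
  proof -
    interpret hom_lie \<phi> by unfold_locales (rule reg)
    \<comment> \<open>\<open>\<tau>\<close> and \<open>\<phi>\<close> differ by a bracket, which has
      zero diagonal, so the entries of \<open>\<tau> e_x\<close> can be taken from
      \<open>\<phi>\<close>.\<close>
    define cs where "cs = map (\<lambda>x. coef (\<phi> (eunit x x)) (xs ! 0) (xs ! 0)) xs"
    let ?\<theta> = "restrict id strict_basis"
    have bij: "bij_betw ?\<theta> strict_basis strict_basis"
      by (auto simp: bij_betw_def inj_on_def)
    have tau_is: "is_tau xs ?\<theta> \<sigma> cs \<tau>"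
      using tau_aut tau_diag tau_unit
      by (auto simp: unit_in_strict_basis is_tau_def cs_def \<tau>_def coef_simps coef_lie_bracket_diag)
    have "tau xs ?\<theta> \<sigma> cs = \<tau>"
      unfolding tau_def using tau_is is_tau_unique[where \<sigma> = \<sigma>, OF xs conn bij sigma_nonzero]
      by (intro the_equality) auto
    then have \<phi>: "\<phi> = conj_by (1 + m) \<circ> tau xs ?\<theta> \<sigma> cs"
      by (simp add: fun_eq_iff phi_tau conj_by_one_plus[OF m_center])
    have "sum_list cs = (\<Sum>x\<in>UNIV. coef (\<phi> (eunit x x)) (xs ! 0) (xs ! 0))"
      unfolding cs_def sum_list_distinct_conv_sum_set[OF assms(1)] xs ..
    also have "\<dots> = coef (\<phi> 1) (xs ! 0) (xs ! 0)"
      unfolding one_eq_sum_idem p.sum coef_sum ..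
    finally have "sum_list cs \<noteq> 0"
      using lie_automorphism_one_coef[OF aut conn] by simp
    moreover have "1 = diag_part (1 + m)" "m = jac_part (1 + m)"
      using diag_jac_unique[of 1 m "1 + m"] one_in_diag_sub m_center
      by (auto simp: center_jac_def)
    \<comment> \<open>Extensionality holds because \<open>\<sigma>\<close> is defined as a
      restriction to \<open>strict_pairs\<close>; it also makes uniqueness as a function on all
      pairs possible.\<close>
    moreover have "\<sigma> \<in> strict_pairs \<rightarrow>\<^sub>E UNIV - {0}"
      using sigma_nonzero by (auto simp: strict_pairs_def \<sigma>_def split: if_splits)
    ultimately have "P (1 + m) ?\<theta> \<sigma> cs"
      unfolding P_def
      using bij \<phi> tau_is sigma_one is_inverse_one_plus[OF m_center] m_center
        monotone_on_max_chains_id compatible_with_id[where \<sigma> = \<sigma>, OF sigma_mult]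
      by (auto simp: unit_group_def tau_exists_def cs_def)
    then show ?thesis by blast
  qed
  moreover have "regular_hom_lie \<phi>" if "P \<beta> \<theta> \<sigma> cs" for \<beta> \<theta> \<sigma> cs
    using tau_form.regular[OF form[OF that]] that by (simp add: P_def)
  ultimately show "regular_hom_lie \<phi> \<longleftrightarrow> (\<exists>\<beta> \<theta> \<sigma> cs. \<beta> \<in> unit_group \<and>
      \<theta> \<in> strict_basis \<rightarrow>\<^sub>E strict_basis \<and> bij_betw \<theta> strict_basis strict_basis \<and>
      monotone_on_max_chains \<theta> \<and>
      \<sigma> \<in> strict_pairs \<rightarrow>\<^sub>E UNIV - {0} \<and> compatible_with \<theta> \<sigma> \<and>
      length cs = length xs \<and> sum_list cs \<noteq> 0 \<and>
      tau_exists xs \<theta> \<sigma> cs \<and> \<phi> = conj_by \<beta> \<circ> tau xs \<theta> \<sigma> cs \<and>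
      (\<forall>b\<in>strict_basis. \<theta> b = b) \<and>
      (\<forall>x y. x < y \<and> \<not> (x \<in> min_elements \<and> y \<in> max_elements) \<longrightarrow> \<sigma> (x, y) = 1) \<and>
      diag_part \<beta> = 1 \<and> jac_part \<beta> \<in> center_jac)"
    unfolding P_def by blast
  fix \<beta> \<theta> \<sigma> cs \<beta>' \<theta>' \<sigma>' cs'
  assume "(\<beta> \<in> unit_group \<and>
      \<theta> \<in> strict_basis \<rightarrow>\<^sub>E strict_basis \<and> bij_betw \<theta> strict_basis strict_basis \<and>
      monotone_on_max_chains \<theta> \<and>
      \<sigma> \<in> strict_pairs \<rightarrow>\<^sub>E UNIV - {0} \<and> compatible_with \<theta> \<sigma> \<and>
      length cs = length xs \<and> sum_list cs \<noteq> 0 \<and>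
      tau_exists xs \<theta> \<sigma> cs \<and> \<phi> = conj_by \<beta> \<circ> tau xs \<theta> \<sigma> cs \<and>
      (\<forall>b\<in>strict_basis. \<theta> b = b) \<and>
      (\<forall>x y. x < y \<and> \<not> (x \<in> min_elements \<and> y \<in> max_elements) \<longrightarrow> \<sigma> (x, y) = 1) \<and>
      diag_part \<beta> = 1 \<and> jac_part \<beta> \<in> center_jac) \<and> (\<beta>' \<in> unit_group \<and>
      \<theta>' \<in> strict_basis \<rightarrow>\<^sub>E strict_basis \<and> bij_betw \<theta>' strict_basis strict_basis \<and>
      monotone_on_max_chains \<theta>' \<and>
      \<sigma>' \<in> strict_pairs \<rightarrow>\<^sub>E UNIV - {0} \<and> compatible_with \<theta>' \<sigma>' \<and>
      length cs' = length xs \<and> sum_list cs' \<noteq> 0 \<and>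
      tau_exists xs \<theta>' \<sigma>' cs' \<and> \<phi> = conj_by \<beta>' \<circ> tau xs \<theta>' \<sigma>' cs' \<and>
      (\<forall>b\<in>strict_basis. \<theta>' b = b) \<and>
      (\<forall>x y. x < y \<and> \<not> (x \<in> min_elements \<and> y \<in> max_elements) \<longrightarrow> \<sigma>' (x, y) = 1) \<and>
      diag_part \<beta>' = 1 \<and> jac_part \<beta>' \<in> center_jac)"
  then have P: "P \<beta> \<theta> \<sigma> cs" and P': "P \<beta>' \<theta>' \<sigma>' cs'"
    unfolding P_def by blast+
  interpret a: tau_form \<phi> "tau xs \<theta> \<sigma> cs" \<sigma> "jac_part \<beta>" by (rule form[OF P])
  interpret b: tau_form \<phi> "tau xs \<theta>' \<sigma>' cs'" \<sigma>' "jac_part \<beta>'" by (rule form[OF P'])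
  \<comment> \<open>All data are recovered from \<open>\<phi>\<close>: \<open>\<beta>\<close> from
    the off-diagonal entries of \<open>\<phi> e_w\<close>, \<open>\<sigma>\<close> from
    \<open>\<phi> e_uv\<close>, and \<open>cs\<close> from the diagonal entries of the
    \<open>\<phi> e_x\<close>.\<close>
  have "coef (jac_part \<beta>) u w = coef (jac_part \<beta>') u w" for u w
  proof (cases "u < w")
    case True
    then show ?thesis using a.phi_idem b.phi_idem by metis
  next
    case False
    then show ?thesis using a.m b.m by (metis center_jac_iff)
  qed
  then have "jac_part \<beta> = jac_part \<beta>'"
    by (simp add: incidence_eq_iff)
  then show "\<beta> = \<beta>'"
    using P P' by (simp add: P_def jac_part_def)
  have "\<theta> f = \<theta>' f" for f
    using P P' by (cases "f \<in> strict_basis") (auto simp: P_def PiE_def extensional_def)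
  then show "\<theta> = \<theta>'" by auto
  have "\<sigma> (u, v) = \<sigma>' (u, v)" for u v
  proof (cases "u < v")
    case True
    have "iscale (\<sigma> (u, v)) (eunit u v) = (iscale (\<sigma>' (u, v)) (eunit u v) :: ('a, 'k) incidence)"
      using a.phi_unit[OF True] b.phi_unit[OF True] by metis
    then show ?thesis
      using unit_nonzero[OF less_imp_le[OF True], where 'k = 'k] by simp
  next
    case False
    then show ?thesis
      using P P' by (auto simp: P_def PiE_def extensional_def strict_pairs_def)
  qed
  then show "\<sigma> = \<sigma>'" by auto
  have "cs ! i = coef (\<phi> (eunit (xs ! i) (xs ! i))) (xs ! 0) (xs ! 0)"
    "cs' ! i = coef (\<phi> (eunit (xs ! i) (xs ! i))) (xs ! 0) (xs ! 0)" if "i < length xs" for i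
    using is_tau[OF P] is_tau[OF P'] that by (simp_all add: is_tau_def a.phi_diag b.phi_diag flip: a.phi_diag)
  then show "cs = cs'"
    using P P' by (intro nth_equalityI) (auto simp: P_def)
qed

end
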